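(* Let $V$ satisfy $(V)$ and $\eta$ satisfy $(\eta)$ (as stated in the context). Fix $\rho_o\in(L^1\cap L^\infty\cap BV)(\mathbb R^n;\mathbb R^m)$. Assume moreover that for an orthogonal matrix $R\in O(n)$: (1) $V_i(w_1R,\dots,w_mR)=R^{-1}\,V_i(w_1,\dots,w_m)$ for $i\in\{1,\dots,m\}$ and all row vectors $w_1,\dots,w_m\in\mathbb R^{1\times n}$; (2) $\eta(Rx)=\eta(x)$ for all $x\in\mathbb R^n$; (3) $\rho_o(Rx)=\rho_o(x)$ for all $x\in\mathbb R^n$. Then the solution $t\mapsto\mathcal G_t\rho_o$ to $\partial_t \rho_i + \nabla\cdot(\rho_i V_i(\nabla\rho*\eta))=0$, $i\in\{1,\dots,m\}$, with initial datum $\rho_o$ at time $0$, is invariant with respect to $R$, i.e. $$(\mathcal G_t\rho_o)(Rx)=(\mathcal G_t\rho_o)(x)\qquad\text{for all }(t,x)\in\mathbb R\times\mathbb R^n.$$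
   Context: $n,m\ge1$ are integers and $\mathbb R_+=[0,+\infty[$. All spaces $\mathbb R^n$, $\mathbb R^{n\times m}$ carry the Euclidean norm. $BV$ is the set of $L^1_{loc}$ functions whose distributional derivative is a Radon measure with finite total variation. $\|u\|_{W^{1,\infty}}=\|u\|_{L^\infty}+\|Du\|_{L^\infty}$. $\nabla$ is the differential operator in the space variable $x$; $DV$ is the total derivative of $V$. Assumption $(\eta)$: $\eta\in (C^3\cap W^{3,1}\cap W^{3,\infty})(\mathbb R^n;\mathbb R)$. Assumption $(V)$: $V\in C^2(\mathbb R^{n\times m};\mathbb R^{n\times m})$, $V(0)=0$ and $\|DV\|_{W^{1,\infty}(\mathbb R^{n\times m};\mathbb R^{(n\times m)^2})}\le L_V$ for an $L_V\in\mathbb R_+$. Write $V=[V_1\cdots V_m]$ with columns $V_i\in\mathbb R^n$. For $\rho=(\rho_1,\dots,\rho_m)$, $\nabla\rho*\eta$ is the $n\times m$ matrix with entries $(\nabla\rho*\eta)_{ji}=\partial_{x_j}(\rho_i*\eta)$, where $(\rho_i(t)*\eta)(x)=\int_{\mathbb R^n}\rho_i(t,\xi)\,\eta(x-\xi)\,d\xi$; that is, its $i$-th column is the transpose of the row vector $\nabla\rho_i*\eta$. Accordingly, for row vectors $w_1,\dots,w_m\in\mathbb R^{1\times n}$, $V_i(w_1,\dots,w_m)$ denotes $V_i$ evaluated at the $n\times m$ matrix whose $i$-th column is $w_i^{\top}$. Solution: for a non trivial real interval $I$, $\rho\in C^0(I;L^1(\mathbb R^n;\mathbb R^m))$ is a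 solution to the system on $I$ if, setting $v_i(t,x)=V_i\big((\nabla\rho*\eta)(t,x)\big)$, each $\rho_i$ is a solution on $I$ of the linear equation $\partial_t\rho_i+\nabla\cdot(\rho_i\,v_i(t,x))=0$, meaning the Lagrangian one: with datum $\rho_{o,i}$ at time $0\in I$, $$\rho_i(t,x)=\rho_{o,i}\big(X_i(0;t,x)\big)\exp\Big(-\int_0^t(\nabla\cdot v_i)\big(\tau,X_i(\tau;t,x)\big)\,d\tau\Big),$$ where $t\mapsto X_i(t;t_o,x_o)$ solves $\dot x=v_i(t,x)$, $x(t_o)=x_o$ (it coincides with the distributional and with the Kružkov entropy solution). Under $(\eta)$ and $(V)$, for every $\rho_o\in(L^1\cap L^\infty\cap BV)(\mathbb R^n;\mathbb R^m)$ there is a unique global solution on $\mathbb R$ with datum $\rho_o$ at time $0$; it is denoted $t\mapsto\mathcal G_t\rho_o$. Functions in $L^1$ are identified when equal a.e.; pointwise statements on solutions are understood for the representative provided by this formula. *)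

theory Defs
  imports "HOL-Analysis.Analysis" "HOL-Probability.Essential_Supremum"
begin

section \<open>Regularity and function spaces\<close>

definition partial :: "'a::euclidean_space \<Rightarrow> ('a \<Rightarrow> 'b::real_normed_vector) \<Rightarrow> 'a \<Rightarrow> 'b" where
  "partial b f x = frechet_derivative f (at x) b"

primrec C_k :: "nat \<Rightarrow> ('a::euclidean_space \<Rightarrow> 'b::real_normed_vector) \<Rightarrow> bool" where
  "C_k 0 f \<longleftrightarrow> continuous_on UNIV f"
| "C_k (Suc k) f \<longleftrightarrow> f differentiable_on UNIV \<and> (\<forall>b\<in>Basis. C_k k (partial b f))"

primrec iterated_partial ::
  "'a::euclidean_space list \<Rightarrow> ('a \<Rightarrow> 'b::real_normed_vector) \<Rightarrow> 'a \<Rightarrow> 'b" where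
  "iterated_partial [] f = f"
| "iterated_partial (b # bs) f = iterated_partial bs (partial b f)"

definition Linf_norm :: "('a::euclidean_space \<Rightarrow> 'b::real_normed_vector) \<Rightarrow> ereal" where
  "Linf_norm f = esssup lebesgue (\<lambda>x. ereal (norm (f x)))"

text \<open>Membership of a \<open>C\<^sup>k\<close> function in \<open>W\<^sup>k\<^sup>,\<^sup>1\<close> and in \<open>W\<^sup>k\<^sup>,\<^sup>\<infinity>\<close>: the distributional
  derivatives of order at most \<open>k\<close> of such a function are its classical ones, and these are
  the derivatives used here. Only meaningful together with \<open>C_k k f\<close>.\<close>

definition W_k_1 :: "nat \<Rightarrow> ('a::euclidean_space \<Rightarrow> real) \<Rightarrow> bool" where
  "W_k_1 k f \<longleftrightarrow>
     (\<forall>bs. set bs \<subseteq> Basis \<and> length bs \<le> k \<longrightarrow> integrable lebesgue (iterated_partial bs f))"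

definition W_k_inf :: "nat \<Rightarrow> ('a::euclidean_space \<Rightarrow> real) \<Rightarrow> bool" where
  "W_k_inf k f \<longleftrightarrow>
     (\<forall>bs. set bs \<subseteq> Basis \<and> length bs \<le> k \<longrightarrow> Linf_norm (iterated_partial bs f) < \<infinity>)"

definition test_function :: "('a::euclidean_space \<Rightarrow> real) \<Rightarrow> bool" where
  "test_function \<phi> \<longleftrightarrow> (\<forall>k. C_k k \<phi>) \<and> (\<exists>K. compact K \<and> (\<forall>x. x \<notin> K \<longrightarrow> \<phi> x = 0))"

definition L1_loc :: "('a::euclidean_space \<Rightarrow> real) \<Rightarrow> bool" where
  "L1_loc u \<longleftrightarrow> (\<forall>K. compact K \<longrightarrow> set_integrable lebesgue K u)"

text \<open>A signed Radon measure of finite total variation is written as the difference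
  \<open>\<mu> - \<nu>\<close> of two finite positive Borel measures (which are automatically Radon).\<close>

definition BV :: "('a::euclidean_space \<Rightarrow> real) \<Rightarrow> bool" where
  "BV u \<longleftrightarrow> L1_loc u \<and>
     (\<forall>b\<in>Basis. \<exists>\<mu> \<nu>. finite_measure \<mu> \<and> finite_measure \<nu> \<and>
        sets \<mu> = sets borel \<and> sets \<nu> = sets borel \<and>
        (\<forall>\<phi>. test_function \<phi> \<longrightarrow>
          (\<integral>x. u x * partial b \<phi> x \<partial>lebesgue) = - ((\<integral>x. \<phi> x \<partial>\<mu>) - (\<integral>x. \<phi> x \<partial>\<nu>))))"

definition L1_Linf_BV :: "(real^'n \<Rightarrow> real^'m) \<Rightarrow> bool" where
  "L1_Linf_BV u \<longleftrightarrow>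
     integrable lebesgue u \<and> Linf_norm u < \<infinity> \<and> (\<forall>i. BV (\<lambda>x. u x $ i))"


section \<open>Assumptions on the kernel and on the velocity\<close>

definition assumption_eta :: "(real^'n \<Rightarrow> real) \<Rightarrow> bool" where
  "assumption_eta \<eta> \<longleftrightarrow> C_k 3 \<eta> \<and> W_k_1 3 \<eta> \<and> W_k_inf 3 \<eta>"

text \<open>Total derivative of a function of an \<open>n \<times> m\<close> matrix, as the array of its partial
  derivatives with respect to the entries; the norm of iterated vector types is then the
  Euclidean one.\<close>

definition total_deriv :: "(real^'m^'n \<Rightarrow> 'b::euclidean_space) \<Rightarrow> real^'m^'n \<Rightarrow> 'b^'m^'n" where
  "total_deriv F W = (\<chi> j i. partial (axis j (axis i 1)) F W)"

definition assumption_V :: "(real^'m^'n \<Rightarrow> real^'m^'n) \<Rightarrow> bool" where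
  "assumption_V V \<longleftrightarrow> C_k 2 V \<and> V 0 = 0 \<and>
     (\<exists>L\<ge>0. Linf_norm (total_deriv V) + Linf_norm (total_deriv (total_deriv V)) \<le> ereal L)"


section \<open>The system and its solutions\<close>

definition convolution :: "(real^'n \<Rightarrow> real) \<Rightarrow> (real^'n \<Rightarrow> real) \<Rightarrow> real^'n \<Rightarrow> real" where
  "convolution f g x = (\<integral>\<xi>. f \<xi> * g (x - \<xi>) \<partial>lebesgue)"

text \<open>The matrix \<open>\<nabla>\<rho> * \<eta>\<close>, with rows indexed by \<open>'n\<close> and columns by \<open>'m\<close>.\<close>

definition grad_conv :: "(real^'n \<Rightarrow> real^'m) \<Rightarrow> (real^'n \<Rightarrow> real) \<Rightarrow> real^'n \<Rightarrow> real^'m^'n" where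
  "grad_conv r \<eta> x = (\<chi> j i. partial (axis j 1) (convolution (\<lambda>\<xi>. r \<xi> $ i) \<eta>) x)"

definition velocity :: "(real^'m^'n \<Rightarrow> real^'m^'n) \<Rightarrow> (real^'n \<Rightarrow> real) \<Rightarrow>
    (real \<Rightarrow> real^'n \<Rightarrow> real^'m) \<Rightarrow> 'm \<Rightarrow> real \<Rightarrow> real^'n \<Rightarrow> real^'n" where
  "velocity V \<eta> \<rho> i t x = column i (V (grad_conv (\<rho> t) \<eta> x))"

definition divergence :: "(real^'n \<Rightarrow> real^'n) \<Rightarrow> real^'n \<Rightarrow> real" where
  "divergence F x = (\<Sum>j\<in>UNIV. partial (axis j 1) F x $ j)"

text \<open>\<open>X t t\<^sub>o x\<^sub>o\<close> is the value at time \<open>t\<close> of the solution of \<open>x' = v(t, x)\<close>, \<open>x(t\<^sub>o) = x\<^sub>o\<close>.\<close>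

definition is_flow :: "real set \<Rightarrow> (real \<Rightarrow> real^'n \<Rightarrow> real^'n) \<Rightarrow>
    (real \<Rightarrow> real \<Rightarrow> real^'n \<Rightarrow> real^'n) \<Rightarrow> bool" where
  "is_flow I v X \<longleftrightarrow> (\<forall>t\<^sub>o\<in>I. \<forall>x\<^sub>o. X t\<^sub>o t\<^sub>o x\<^sub>o = x\<^sub>o \<and>
     (\<forall>t\<in>I. ((\<lambda>s. X s t\<^sub>o x\<^sub>o) has_vector_derivative v t (X t t\<^sub>o x\<^sub>o)) (at t within I)))"

text \<open>Lagrangian solutions of \<open>\<partial>\<^sub>t r + \<nabla>\<cdot>(r v) = 0\<close>, \<open>r(0) = r\<^sub>o\<close>. The formula is required for
  every \<open>x\<close>, not just almost every one: this selects the representative of the \<open>L\<^sup>1\<close> class of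
  \<open>r t\<close> to which pointwise statements refer. The time integral is oriented, \<open>t\<close> may be negative.\<close>

definition lagrangian_solution :: "real set \<Rightarrow> (real \<Rightarrow> real^'n \<Rightarrow> real^'n) \<Rightarrow>
    (real^'n \<Rightarrow> real) \<Rightarrow> (real \<Rightarrow> real^'n \<Rightarrow> real) \<Rightarrow> bool" where
  "lagrangian_solution I v r\<^sub>o r \<longleftrightarrow> (\<exists>X. is_flow I v X \<and>
     (\<forall>t\<in>I. \<forall>x. r t x =
        r\<^sub>o (X 0 t x) * exp (- (LBINT \<tau>=0..t. divergence (v \<tau>) (X \<tau> t x)))))"

definition C0_L1 :: "real set \<Rightarrow> (real \<Rightarrow> real^'n \<Rightarrow> real^'m) \<Rightarrow> bool" where
  "C0_L1 I \<rho> \<longleftrightarrow> (\<forall>t\<in>I. integrable lebesgue (\<rho> t)) \<and>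
     (\<forall>t\<in>I. ((\<lambda>s. \<integral>x. norm (\<rho> s x - \<rho> t x) \<partial>lebesgue) \<longlongrightarrow> 0) (at t within I))"

definition solution_on :: "real set \<Rightarrow> (real^'m^'n \<Rightarrow> real^'m^'n) \<Rightarrow> (real^'n \<Rightarrow> real) \<Rightarrow>
    (real^'n \<Rightarrow> real^'m) \<Rightarrow> (real \<Rightarrow> real^'n \<Rightarrow> real^'m) \<Rightarrow> bool" where
  "solution_on I V \<eta> \<rho>\<^sub>o \<rho> \<longleftrightarrow>
     is_interval I \<and> interior I \<noteq> {} \<and> 0 \<in> I \<and> C0_L1 I \<rho> \<and>
     (\<forall>i. lagrangian_solution I (velocity V \<eta> \<rho> i) (\<lambda>x. \<rho>\<^sub>o x $ i) (\<lambda>t x. \<rho> t x $ i))"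

text \<open>The \<open>n \<times> m\<close> matrix whose \<open>i\<close>-th column is the transpose of the row vector \<open>w i\<close>.\<close>

definition matrix_of_columns :: "('m \<Rightarrow> real^'n) \<Rightarrow> real^'m^'n" where
  "matrix_of_columns w = (\<chi> j i. w i $ j)"

end

theory Submission
  imports Defs
begin

text \<open>
  The solution is given by the Lagrangian formula along the flows \<open>X\<^sub>i\<close> of the velocities
  \<open>v\<^sub>i\<close>, and \<open>\<rho>\<close> enters \<open>v\<^sub>i\<close> only through \<open>\<nabla>\<rho> * \<eta>\<close>. The Jacobian determinant of
  \<open>x \<mapsto> X\<^sub>i(0; t, x)\<close> is the exponential factor of that formula (Liouville), so \<open>\<rho>\<^sub>i(t)\<close> is the
  image of \<open>\<rho>\<^sub>o\<^sub>,\<^sub>i\<close> under \<open>y \<mapsto> X\<^sub>i(t; 0, y)\<close> and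
  \<open>(\<partial>\<^sub>j\<rho>\<^sub>k * \<eta>)(t, x) = \<integral> \<rho>\<^sub>o\<^sub>,\<^sub>k(y) \<partial>\<^sub>j\<eta>(x - X\<^sub>k(t; 0, y)) dy\<close>.
  The characteristics issued at time \<open>0\<close> thus solve a closed system of ordinary differential
  equations, a mean-field system in which the datum only provides weights:
  \<open>Y\<^sub>i'(t, y) = V\<^sub>i(\<integral> \<rho>\<^sub>o\<^sub>,\<^sub>k(z) \<nabla>\<eta>(Y\<^sub>i(t, y) - Y\<^sub>k(t, z)) dz)\<close>, \<open>Y\<^sub>i(0, y) = y\<close>.

  This system has at most one solution, because \<open>V\<close> and \<open>\<nabla>\<eta>\<close> are Lipschitz: a Gronwall argument
  for the whole family \<open>\<bar>Y\<^sub>i(t, y) - Z\<^sub>i(t, y)\<bar>\<^sup>2\<close>, indexed by \<open>(i, y)\<close>, applies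
  (\<open>gronwall_family\<close>, \<open>mean_field_characteristics_unique\<close>). The hypotheses on \<open>V\<close>, \<open>\<eta>\<close> and
  \<open>\<rho>\<^sub>o\<close> make the system equivariant: with \<open>X\<^sub>i(t; 0, y)\<close> also
  \<open>R X\<^sub>i(t; 0, R\<^sup>-\<^sup>1 y)\<close> is a solution (\<open>mean_field_equivariant\<close>), and it has the same initial value.
  Hence the two coincide; the flows commute with \<open>R\<close>, so do the velocities, the divergences are
  invariant, and the Lagrangian formula gives \<open>\<rho>(t, R x) = \<rho>(t, x)\<close> at every point.
  So the comparison takes place between characteristics, where it reduces to the Lipschitz bounds,
  and not between densities.

  Most of the file prepares the representation of \<open>\<nabla>\<rho> * \<eta>\<close>: differentiability of the flow in
  its initial point (\<open>flow_differentiable\<close>, by comparison with the linearised equation) together with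
  Liouville's formula, the change of variables in \<open>\<real>\<^sup>n\<close>, and the regularity of
  \<open>v\<^sub>i\<close> (\<open>convolution_has_derivative\<close>, \<open>velocity_has_derivative\<close>); they are combined in
  \<open>lagrangian_pushforward\<close>. Differential equations are studied on the time interval \<open>[0, 1]\<close>; other
  intervals, including those that lead backwards in time, are reached by an affine
  parametrisation.
\<close>

section \<open>Gronwall estimates\<close>

lemma nonpos_derivative_le_start:
  fixes \<phi> :: "real \<Rightarrow> real"
  assumes der: "\<And>s. s \<in> {0..1} \<Longrightarrow> (\<phi> has_real_derivative \<phi>' s) (at s within {0..1})"
    and le: "\<And>s. s \<in> {0..1} \<Longrightarrow> \<phi>' s \<le> 0" and t: "t \<in> {0..1}"
  shows "\<phi> t \<le> \<phi> 0"
proof -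
  have "\<exists>s\<in>{0..t}. \<phi> t - \<phi> 0 = \<phi>' s * (t - 0)"
  proof (rule mvt_very_simple)
    show "0 \<le> t" using t by simp
    fix s assume "0 \<le> s" "s \<le> t"
    then have "(\<phi> has_real_derivative \<phi>' s) (at s within {0..t})"
      using t by (intro DERIV_subset[OF der]) auto
    then show "(\<phi> has_derivative (\<lambda>x. \<phi>' s * x)) (at s within {0..t})"
      by (simp add: has_field_derivative_def)
  qed
  then obtain s where s: "s \<in> {0..t}" "\<phi> t - \<phi> 0 = \<phi>' s * t" by auto
  have "\<phi>' s * t \<le> 0" using s t le[of s] by (intro mult_nonpos_nonneg) auto
  with s show ?thesis by simp
qed

text \<open>The squared norm is differentiable where the norm need not be, and satisfies
  \<open>u' \<le> (2L + 1) u + d\<^sup>2\<close> by the inequality between arithmetic and geometric mean;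
  the summand \<open>1\<close> in the exponent is the price for that.\<close>

lemma gronwall_norm:
  fixes e :: "real \<Rightarrow> 'a::real_inner"
  assumes der: "\<And>t. t \<in> {0..1} \<Longrightarrow> (e has_vector_derivative e' t) (at t within {0..1})"
    and bound: "\<And>t. t \<in> {0..1} \<Longrightarrow> norm (e' t) \<le> L * norm (e t) + d"
    and L: "0 \<le> L" and d: "0 \<le> d" and t: "t \<in> {0..1}"
  shows "norm (e t) \<le> (norm (e 0) + d) * exp (L + 1)"
proof -
  define a where "a = 2 * L + 1"
  \<comment> \<open>This function decreases: it combines an integrating factor with the accumulated defect.\<close>
  define \<phi> where "\<phi> s = (e s \<bullet> e s) * exp (- a * s) - d\<^sup>2 * s" for s
  define \<phi>' where "\<phi>' s = (2 * (e s \<bullet> e' s) - a * (e s \<bullet> e s)) * exp (- a * s) - d\<^sup>2" for s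
  have inner': "((\<lambda>s. e s \<bullet> e s) has_real_derivative 2 * (e s \<bullet> e' s)) (at s within {0..1})"
    if "s \<in> {0..1}" for s
  proof -
    have "((\<lambda>s. e s \<bullet> e s) has_derivative (\<lambda>h. e s \<bullet> (h *\<^sub>R e' s) + (h *\<^sub>R e' s) \<bullet> e s)) (at s within {0..1})"
      using der[OF that] unfolding has_vector_derivative_def by (intro has_derivative_inner)
    moreover have "(\<lambda>h. e s \<bullet> (h *\<^sub>R e' s) + (h *\<^sub>R e' s) \<bullet> e s) = (\<lambda>h. 2 * (e s \<bullet> e' s) * h)"
      by (auto simp: inner_commute)
    ultimately show ?thesis by (simp add: has_field_derivative_def)
  qed
  have "\<phi> t \<le> \<phi> 0"
  proof (rule nonpos_derivative_le_start[OF _ _ t])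
    fix s :: real assume s: "s \<in> {0..1}"
    show "(\<phi> has_real_derivative \<phi>' s) (at s within {0..1})"
      unfolding \<phi>_def \<phi>'_def
      by (rule derivative_eq_intros inner'[OF s] refl | simp add: algebra_simps)+
    have "2 * (e s \<bullet> e' s) \<le> 2 * (norm (e s) * norm (e' s))"
      using norm_cauchy_schwarz by auto
    also have "\<dots> \<le> 2 * (norm (e s) * (L * norm (e s) + d))"
      using bound[OF s] by (simp add: mult_left_mono)
    also have "\<dots> = 2 * L * (norm (e s))\<^sup>2 + 2 * norm (e s) * d"
      by (simp add: algebra_simps power2_eq_square)
    also have "2 * norm (e s) * d \<le> (norm (e s))\<^sup>2 + d\<^sup>2"
      by (rule sum_squares_bound)
    finally have "2 * (e s \<bullet> e' s) - a * (e s \<bullet> e s) \<le> d\<^sup>2"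
      unfolding a_def power2_norm_eq_inner by (simp add: algebra_simps)
    then have "(2 * (e s \<bullet> e' s) - a * (e s \<bullet> e s)) * exp (- a * s) \<le> d\<^sup>2 * exp (- a * s)"
      by (rule mult_right_mono) simp
    also have "\<dots> \<le> d\<^sup>2 * 1"
    proof -
      have "0 \<le> a * s" using s L by (intro mult_nonneg_nonneg) (auto simp: a_def)
      then show ?thesis by (intro mult_left_mono) simp_all
    qed
    finally show "\<phi>' s \<le> 0" by (simp add: \<phi>'_def)
  qed
  then have "(norm (e t))\<^sup>2 * exp (- a * t) \<le> (norm (e 0))\<^sup>2 + d\<^sup>2 * t"
    by (simp add: \<phi>_def power2_norm_eq_inner)
  also have "\<dots> \<le> (norm (e 0))\<^sup>2 + d\<^sup>2 * 1" using t by (intro add_mono mult_left_mono) auto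
  also have "\<dots> \<le> (norm (e 0) + d)\<^sup>2" using d by (simp add: power2_sum)
  finally have "(norm (e t))\<^sup>2 \<le> (norm (e 0) + d)\<^sup>2 * exp (a * t)"
    unfolding mult_minus_left exp_minus by (simp only: pos_divide_le_eq[OF exp_gt_zero] divide_inverse[symmetric])
  also have "\<dots> \<le> (norm (e 0) + d)\<^sup>2 * exp (2 * (L + 1))"
  proof -
    have "a * t \<le> a * 1" using t L by (intro mult_left_mono) (auto simp: a_def)
    then show ?thesis by (intro mult_left_mono) (auto simp: a_def)
  qed
  also have "\<dots> = ((norm (e 0) + d) * exp (L + 1))\<^sup>2"
    using exp_double[of "L + 1"] by (simp only: power_mult_distrib)
  finally have "(norm (e t))\<^sup>2 \<le> ((norm (e 0) + d) * exp (L + 1))\<^sup>2" .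
  then show ?thesis
    by (rule power2_le_imp_le) (intro mult_nonneg_nonneg add_nonneg_nonneg norm_ge_zero d exp_ge_zero)
qed

text \<open>Gronwall's lemma for a coupled family, in which each derivative is controlled by the supremum
  over all members. Since that supremum need not be differentiable in \<open>t\<close>, the estimate is iterated:
  \<open>u\<^sub>i(t) \<le> M (Ct)\<^sup>k / k!\<close> for all \<open>i\<close> improves itself from \<open>k\<close> to \<open>k + 1\<close> by integration.\<close>

lemma gronwall_family:
  fixes u :: "'i \<Rightarrow> real \<Rightarrow> real"
  assumes der: "\<And>i t. t \<in> {0..1} \<Longrightarrow> (u i has_real_derivative u' i t) (at t within {0..1})"
    and init: "\<And>i. u i 0 \<le> 0"
    and bound: "\<And>i t. t \<in> {0..1} \<Longrightarrow> u i t \<le> M"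
    and closed: "\<And>i t S. t \<in> {0..1} \<Longrightarrow> (\<And>j. u j t \<le> S) \<Longrightarrow> u' i t \<le> C * S"
    and t: "t \<in> {0..1}"
  shows "u i t \<le> 0"
proof -
  have *: "u i t \<le> M * ((C * t) ^ k / fact k)" if "t \<in> {0..1}" for k i t
    using that
  proof (induction k arbitrary: i t)
    case 0 then show ?case using bound by simp
  next
    case (Suc k)
    define \<phi> where "\<phi> s = u i s - M * ((C * s) ^ Suc k / fact (Suc k))" for s
    define \<phi>' where "\<phi>' s = u' i s - C * (M * ((C * s) ^ k / fact k))" for s
    have "\<phi> t \<le> \<phi> 0"
    proof (rule nonpos_derivative_le_start[OF _ _ Suc.prems])
      fix s :: real assume s: "s \<in> {0..1}"
      show "(\<phi> has_real_derivative \<phi>' s) (at s within {0..1})"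
        unfolding \<phi>_def \<phi>'_def
        by (rule derivative_eq_intros der[OF s] refl | simp add: divide_simps)+
      show "\<phi>' s \<le> 0" using closed[OF s Suc.IH[OF s]] by (simp add: \<phi>'_def)
    qed
    then show ?case using init[of i] by (simp add: \<phi>_def)
  qed
  have "(\<lambda>k. (C * t) ^ k / fact k) \<longlonglongrightarrow> 0"
    using summable_LIMSEQ_zero[OF summable_exp[of "C * t"]] by (simp add: field_simps)
  then have "(\<lambda>k. M * ((C * t) ^ k / fact k)) \<longlonglongrightarrow> M * 0"
    by (intro tendsto_intros)
  then show ?thesis
    using *[OF t] by (intro LIMSEQ_le_const[where X = "\<lambda>k. M * ((C * t) ^ k / fact k)"]) auto
qed

section \<open>Existence of solutions of Lipschitz equations\<close>

text \<open>Picard iteration. Consecutive iterates differ by at most \<open>c (Kt)\<^sup>k / k!\<close>, so that they converge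
  uniformly on the whole interval, however large \<open>K\<close> is; their derivatives then converge
  uniformly as well. The result is used for the linearisation of a flow, where the
  unknown is a matrix.\<close>

lemma lipschitz_ode_solution_exists:
  fixes h :: "real \<Rightarrow> 'a::euclidean_space \<Rightarrow> 'a"
  assumes cont: "continuous_on ({0..1} \<times> UNIV) (\<lambda>(t, x). h t x)"
    and lip: "\<And>t x y. t \<in> {0..1} \<Longrightarrow> norm (h t x - h t y) \<le> K * norm (x - y)"
    and K: "0 \<le> K"
  obtains z where "z 0 = z\<^sub>0"
    "\<And>t. t \<in> {0..1} \<Longrightarrow> (z has_vector_derivative h t (z t)) (at t within {0..1})"
proof -
  define I :: "real set" where "I = {0..1}"
  define P where "P f t = z\<^sub>0 + integral {0..t} (\<lambda>s. h s (f s))" for f t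
  define X where "X k = (P ^^ k) (\<lambda>_. z\<^sub>0)" for k
  have X0: "X 0 = (\<lambda>_. z\<^sub>0)" and XS: "X (Suc k) = P (X k)" for k by (auto simp: X_def)
  have hf: "continuous_on I (\<lambda>s. h s (f s))" if "continuous_on I f" for f
  proof -
    have "continuous_on I (\<lambda>s. (s, f s))" using that by (intro continuous_intros)
    from continuous_on_compose2[OF cont this] show ?thesis by (auto simp: I_def)
  qed
  have P': "(P f has_vector_derivative h t (f t)) (at t within I)"
    if "continuous_on I f" "t \<in> I" for f t
    unfolding P_def I_def
    using integral_has_vector_derivative[OF hf[OF that(1), unfolded I_def]] that(2)
    by (auto simp: I_def intro!: derivative_eq_intros)
  have Xc: "continuous_on I (X k)" for k
  proof (induction k)
    case (Suc k)
    then show ?case unfolding XS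
      using P' has_vector_derivative_continuous continuous_on_eq_continuous_within by blast
  qed (simp add: X0)
  have X': "(X (Suc k) has_vector_derivative h t (X k t)) (at t within I)" if "t \<in> I" for k t
    unfolding XS by (rule P'[OF Xc that])
  have Xstart: "X k 0 = z\<^sub>0" for k by (cases k) (simp_all add: X0 XS P_def)
  obtain c where c: "\<And>t. t \<in> I \<Longrightarrow> norm (X 1 t - X 0 t) \<le> c"
  proof -
    have "compact ((\<lambda>t. X 1 t - X 0 t) ` I)"
      by (intro compact_continuous_image continuous_intros Xc) (simp add: I_def)
    from compact_imp_bounded[OF this] obtain c where "\<forall>v\<in>(\<lambda>t. X 1 t - X 0 t) ` I. norm v \<le> c"
      unfolding bounded_iff by blast
    then show ?thesis by (intro that[of c]) blast
  qed
  have D: "norm (X (Suc k) t - X k t) \<le> c * ((K * t) ^ k / fact k)" if "t \<in> I" for k t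
    using that
  proof (induction k arbitrary: t)
    case 0 then show ?case using c by simp
  next
    case (Suc k)
    define g where "g s = X (Suc (Suc k)) s - X (Suc k) s" for s
    define \<phi> where "\<phi> s = c * ((K * s) ^ Suc k / fact (Suc k))" for s
    have "norm (g t - g 0) \<le> \<phi> t - \<phi> 0" if "0 < t"
    proof (rule differentiable_bound_general[OF that])
      have sub: "{0..t} \<subseteq> I" using Suc.prems by (auto simp: I_def)
      show "continuous_on {0..t} g" "continuous_on {0..t} \<phi>"
        unfolding g_def \<phi>_def
        by (auto intro!: continuous_intros continuous_on_subset[OF Xc sub])
      fix s assume s: "0 < s" "s < t"
      then have sI: "s \<in> I" "s \<in> interior I" using Suc.prems by (auto simp: I_def)
      have "(g has_vector_derivative h s (X (Suc k) s) - h s (X k s)) (at s within I)"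
        unfolding g_def by (intro derivative_intros X' sI)
      then show "(g has_vector_derivative h s (X (Suc k) s) - h s (X k s)) (at s)"
        using at_within_interior[OF sI(2)] by simp
      show "(\<phi> has_vector_derivative K * (c * ((K * s) ^ k / fact k))) (at s)"
        unfolding \<phi>_def has_real_derivative_iff_has_vector_derivative[symmetric]
        by (rule derivative_eq_intros refl | simp add: divide_simps)+
      show "norm (h s (X (Suc k) s) - h s (X k s)) \<le> K * (c * ((K * s) ^ k / fact k))"
        using lip[of s "X (Suc k) s" "X k s"] mult_left_mono[OF Suc.IH[OF sI(1)] K] sI
        by (simp add: I_def)
    qed
    moreover have "0 \<le> t" using Suc.prems by (simp add: I_def)
    ultimately show ?case by (cases "t = 0") (auto simp: g_def \<phi>_def Xstart)
  qed
  have "uniform_limit I (\<lambda>n t. \<Sum>k<n. X (Suc k) t - X k t) (\<lambda>t. \<Sum>k. X (Suc k) t - X k t) sequentially"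
  proof (rule Weierstrass_m_test)
    show "summable (\<lambda>k. c * (K ^ k / fact k))"
      using summable_exp[of K] by (intro summable_mult) (simp add: field_simps)
    fix k t assume t: "t \<in> I"
    have c0: "0 \<le> c" using c[OF t] norm_ge_zero order_trans by blast
    have "(K * t) ^ k \<le> K ^ k"
      using t K by (intro power_mono) (auto simp: I_def mult_left_le)
    then have "c * ((K * t) ^ k / fact k) \<le> c * (K ^ k / fact k)"
      using c0 by (intro mult_left_mono divide_right_mono) auto
    with D[OF t, of k] show "norm (X (Suc k) t - X k t) \<le> c * (K ^ k / fact k)" by linarith
  qed
  moreover have "(\<Sum>k<n. X (Suc k) t - X k t) = X n t - z\<^sub>0" for n t
    using sum_lessThan_telescope[of "\<lambda>k. X k t" n] by (simp only: X0)
  ultimately have ul: "uniform_limit I (\<lambda>n t. X n t - z\<^sub>0) (\<lambda>t. \<Sum>k. X (Suc k) t - X k t) sequentially"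
    by simp
  define z where "z t = z\<^sub>0 + (\<Sum>k. X (Suc k) t - X k t)" for t
  have lim: "uniform_limit I X z sequentially"
  proof -
    have "uniform_limit I (\<lambda>n t. z\<^sub>0 + (X n t - z\<^sub>0)) z sequentially"
      unfolding z_def[abs_def] by (rule uniform_limit_add[OF uniform_limit_const ul])
    then show ?thesis by simp
  qed
  have conv: "(\<lambda>n. X n t) \<longlonglongrightarrow> z t" if "t \<in> I" for t
    by (rule tendsto_uniform_limitI[OF lim that])
  have "\<exists>g. \<forall>t\<in>I. (\<lambda>n. X (Suc n) t) \<longlonglongrightarrow> g t \<and> (g has_derivative (\<lambda>r. r *\<^sub>R h t (z t))) (at t within I)"
  proof (rule has_derivative_sequence)
    show "convex I" "0 \<in> I" by (auto simp: I_def)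
    show "(X (Suc n) has_derivative (\<lambda>r. r *\<^sub>R h t (X n t))) (at t within I)" if "t \<in> I" for n t
      using X'[OF that] by (simp add: has_vector_derivative_def)
    show "(\<lambda>n. X (Suc n) 0) \<longlonglongrightarrow> z\<^sub>0" by (simp add: Xstart)
    fix e :: real assume e: "e > 0"
    then have "\<forall>\<^sub>F n in sequentially. \<forall>t\<in>I. dist (X n t) (z t) < e / (K + 1)"
      using lim K by (auto simp: uniform_limit_iff)
    then show "\<forall>\<^sub>F n in sequentially. \<forall>t\<in>I. \<forall>r. norm (r *\<^sub>R h t (X n t) - r *\<^sub>R h t (z t)) \<le> e * norm r"
    proof (rule eventually_mono, intro ballI allI)
      fix n t and r :: real assume *: "\<forall>t\<in>I. dist (X n t) (z t) < e / (K + 1)" and t: "t \<in> I"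
      have "norm (h t (X n t) - h t (z t)) \<le> K * norm (X n t - z t)"
        using lip t by (simp add: I_def)
      also have "\<dots> \<le> K * (e / (K + 1))"
        using * t K by (intro mult_left_mono) (auto simp: dist_norm less_imp_le)
      also have "\<dots> \<le> e" using K e by (simp add: field_simps)
      finally have "\<bar>r\<bar> * norm (h t (X n t) - h t (z t)) \<le> \<bar>r\<bar> * e" by (intro mult_left_mono) auto
      then show "norm (r *\<^sub>R h t (X n t) - r *\<^sub>R h t (z t)) \<le> e * norm r"
        by (simp add: scaleR_diff_right[symmetric] mult.commute)
    qed
  qed
  then obtain g where g: "\<And>t. t \<in> I \<Longrightarrow> (\<lambda>n. X (Suc n) t) \<longlonglongrightarrow> g t"
    "\<And>t. t \<in> I \<Longrightarrow> (g has_vector_derivative h t (z t)) (at t within I)"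
    by (auto simp: has_vector_derivative_def)
  have gz: "g t = z t" if "t \<in> I" for t
    using LIMSEQ_unique[OF g(1)[OF that] LIMSEQ_Suc[OF conv[OF that]]] .
  show ?thesis
  proof (rule that)
    show "g 0 = z\<^sub>0" using g(1)[of 0] by (auto simp: I_def Xstart LIMSEQ_const_iff)
    show "(g has_vector_derivative h t (g t)) (at t within {0..1})" if "t \<in> {0..1}" for t
      using g(2)[of t] gz[of t] that by (simp add: I_def)
  qed
qed

section \<open>Liouville's formula\<close>

lemma det_replace_row_by_product_row:
  fixes A Z :: "real^'n^'n"
  shows "det (\<chi> r. if r = i then (A ** Z) $ i else Z $ r) = A $ i $ i * det Z"
proof -
  have row: "(A ** Z) $ i = (\<Sum>k\<in>UNIV. A $ i $ k *s Z $ k)"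
    by (simp add: vec_eq_iff matrix_matrix_mult_def)
  have single: "det (\<chi> r. if r = i then Z $ k else Z $ r) = (if k = i then det Z else 0)" for k
  proof (cases "k = i")
    case True
    then have "(\<chi> r. if r = i then Z $ k else Z $ r) = Z" by (simp add: vec_eq_iff)
    with True show ?thesis by simp
  next
    case False
    then show ?thesis
      by (simp, intro det_identical_rows[of i k]) (auto simp: row_def vec_eq_iff)
  qed
  have "det (\<chi> r. if r = i then (A ** Z) $ i else Z $ r)
      = (\<Sum>k\<in>UNIV. det (\<chi> r. if r = i then A $ i $ k *s Z $ k else Z $ r))"
    unfolding row by (rule det_linear_row_sum) simp
  also have "\<dots> = (\<Sum>k\<in>UNIV. A $ i $ k * det (\<chi> r. if r = i then Z $ k else Z $ r))"
    by (intro sum.cong refl det_row_mul)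
  also have "\<dots> = A $ i $ i * det Z"
    unfolding single by (subst sum.remove[of _ i]) auto
  finally show ?thesis .
qed

text \<open>Differentiating a determinant row by row replaces one row at a time by the corresponding row of
  \<open>A ** Z\<close>, a combination of the rows of \<open>Z\<close>. All summands of it except the
  one with the row itself repeat a row and drop out, which leaves the diagonal entries of \<open>A\<close>.\<close>

lemma det_has_derivative_trace:
  fixes Z :: "real \<Rightarrow> real^'n^'n"
  assumes Z: "(Z has_vector_derivative A ** Z t) (at t within S)"
  shows "((\<lambda>s. det (Z s)) has_real_derivative trace A * det (Z t)) (at t within S)"
proof -
  have entry: "((\<lambda>s. Z s $ i $ j) has_real_derivative (A ** Z t) $ i $ j) (at t within S)" for i j
    unfolding has_real_derivative_iff_has_vector_derivative
    by (intro bounded_linear.has_vector_derivative[OF bounded_linear_vec_nth] Z)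
  have prod': "((\<lambda>s. \<Prod>i\<in>UNIV. Z s $ i $ p i) has_real_derivative
      (\<Sum>i\<in>UNIV. (A ** Z t) $ i $ p i * (\<Prod>r\<in>UNIV - {i}. Z t $ r $ p r))) (at t within S)" for p
  proof -
    have "((\<lambda>s. \<Prod>i\<in>UNIV. Z s $ i $ p i) has_derivative
        (\<lambda>y. \<Sum>i\<in>UNIV. ((A ** Z t) $ i $ p i * y) * (\<Prod>r\<in>UNIV - {i}. Z t $ r $ p r))) (at t within S)"
    proof (rule has_derivative_prod)
      fix i
      show "((\<lambda>s. Z s $ i $ p i) has_derivative (\<lambda>y. (A ** Z t) $ i $ p i * y)) (at t within S)"
        using entry[of i "p i"] by (simp add: has_field_derivative_def)
    qed
    moreover have "(\<lambda>y. \<Sum>i\<in>UNIV. ((A ** Z t) $ i $ p i * y) * (\<Prod>r\<in>UNIV - {i}. Z t $ r $ p r))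
        = (*) (\<Sum>i\<in>UNIV. (A ** Z t) $ i $ p i * (\<Prod>r\<in>UNIV - {i}. Z t $ r $ p r))"
      by (rule ext) (simp add: sum_distrib_right mult.assoc mult.commute[of _ "prod _ _"])
    ultimately show ?thesis by (simp add: has_field_derivative_def)
  qed
  have "((\<lambda>s. det (Z s)) has_real_derivative
      (\<Sum>p | p permutes UNIV. of_int (sign p) *
        (\<Sum>i\<in>UNIV. (A ** Z t) $ i $ p i * (\<Prod>r\<in>UNIV - {i}. Z t $ r $ p r)))) (at t within S)"
    unfolding det_def by (rule DERIV_sum, rule DERIV_cmult, rule prod')
  also have "(\<Sum>p | p permutes UNIV. of_int (sign p) *
        (\<Sum>i\<in>UNIV. (A ** Z t) $ i $ p i * (\<Prod>r\<in>UNIV - {i}. Z t $ r $ p r)))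
     = (\<Sum>i\<in>UNIV. det (\<chi> r. if r = i then (A ** Z t) $ i else Z t $ r))"
  proof -
    have "(A ** Z t) $ i $ p i * (\<Prod>r\<in>UNIV - {i}. Z t $ r $ p r)
        = (\<Prod>r\<in>UNIV. (\<chi> r. if r = i then (A ** Z t) $ i else Z t $ r) $ r $ p r)" for p :: "'n \<Rightarrow> 'n" and i
      by (subst prod.remove[of UNIV i]) (auto intro!: arg_cong2[where f="(*)"] prod.cong)
    then show ?thesis
      unfolding det_def sum_distrib_left by (subst sum.swap) simp
  qed
  also have "\<dots> = trace A * det (Z t)"
    by (simp add: det_replace_row_by_product_row trace_def sum_distrib_right)
  finally show ?thesis .
qed

section \<open>Differentiability of a flow in its initial point\<close>

lemma trajectories_lipschitz:
  fixes Y :: "real \<Rightarrow> 'b \<Rightarrow> 'a::real_inner"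
  assumes lip: "\<And>s x y. s \<in> {0..1} \<Longrightarrow> norm (w s x - w s y) \<le> L * norm (x - y)"
    and flow: "\<And>x s. s \<in> {0..1} \<Longrightarrow> ((\<lambda>s. Y s x) has_vector_derivative w s (Y s x)) (at s within {0..1})"
    and L: "0 \<le> L" and s: "s \<in> {0..1}"
  shows "norm (Y s x - Y s y) \<le> norm (Y 0 x - Y 0 y) * exp (L + 1)"
proof -
  have "norm (Y s x - Y s y) \<le> (norm (Y 0 x - Y 0 y) + 0) * exp (L + 1)"
  proof (rule gronwall_norm[OF _ _ L order_refl s])
    fix r :: real assume r: "r \<in> {0..1}"
    show "((\<lambda>s. Y s x - Y s y) has_vector_derivative w r (Y r x) - w r (Y r y)) (at r within {0..1})"
      by (intro has_vector_derivative_diff flow r)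
    show "norm (w r (Y r x) - w r (Y r y)) \<le> L * norm (Y r x - Y r y) + 0"
      using lip[OF r] by simp
  qed
  then show ?thesis by simp
qed

lemma bounded_bilinear_matrix_product:
  "bounded_bilinear ((**) :: real^'n^'n \<Rightarrow> real^'n^'n \<Rightarrow> real^'n^'n)"
  unfolding bilinear_conv_bounded_bilinear[symmetric] bilinear_def linear_iff
  by (simp add: matrix_add_ldistrib scalar_matrix_assoc matrix_scalar_ac)
    (simp add: matrix_matrix_mult_def vec_eq_iff sum.distrib distrib_right)

lemma bounded_bilinear_matrix_vector_product:
  "bounded_bilinear ((*v) :: real^'n^'n \<Rightarrow> real^'n \<Rightarrow> real^'n)"
  unfolding bilinear_conv_bounded_bilinear[symmetric] bilinear_def linear_iff
  by (simp add: matrix_vector_right_distrib matrix_vector_mult_add_rdistrib matrix_vector_mult_scaleR scaleR_matrix_vector_assoc)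

text \<open>The derivative is the value \<open>Z 1\<close> of the solution of the linearised equation
  \<open>Z' = A Z\<close>, \<open>Z 0 = 1\<close> along the trajectory of \<open>x\<close>. Gronwall's lemma shows that
  \<open>Y s y - Y s x - Z s (y - x)\<close> is \<open>o(y - x)\<close>: its equation has a defect that is small because
  \<open>A\<close> is uniformly continuous near the trajectory. The determinant is expressed by an
  antiderivative \<open>q\<close> of the trace, which spares a substitution in the time integral when the
  lemma is applied to a reparametrised flow.\<close>

lemma flow_differentiable:
  fixes w :: "real \<Rightarrow> real^'n \<Rightarrow> real^'n" and A :: "real \<Rightarrow> real^'n \<Rightarrow> real^'n^'n"
  assumes lip: "\<And>s x y. s \<in> {0..1} \<Longrightarrow> norm (w s x - w s y) \<le> L * norm (x - y)" and L: "0 \<le> L"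
    and der: "\<And>s x. s \<in> {0..1} \<Longrightarrow> (w s has_derivative (\<lambda>h. A s x *v h)) (at x)"
    and contA: "continuous_on ({0..1} \<times> UNIV) (\<lambda>(s, x). A s x)"
    and start: "\<And>x. Y 0 x = x"
    and flow: "\<And>x s. s \<in> {0..1} \<Longrightarrow> ((\<lambda>s. Y s x) has_vector_derivative w s (Y s x)) (at s within {0..1})"
    and q: "\<And>s. s \<in> {0..1} \<Longrightarrow> (q has_real_derivative trace (A s (Y s x))) (at s within {0..1})"
  obtains Z where "(Y 1 has_derivative (\<lambda>h. Z *v h)) (at x)" "det Z = exp (q 1 - q 0)"
proof -
  have contY: "continuous_on {0..1} (\<lambda>s. Y s x)" for x
    unfolding continuous_on_eq_continuous_within
    by (intro ballI has_vector_derivative_continuous[OF flow])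
  define B where "B s = A s (Y s x)" for s
  have contB: "continuous_on {0..1} B"
  proof -
    have "continuous_on {0..1} (\<lambda>s. (s, Y s x))" by (intro continuous_intros contY)
    from continuous_on_compose2[OF contA this] show ?thesis by (auto simp: B_def)
  qed
  note bilin = bounded_bilinear_matrix_product[where 'n = 'n]
    and bilinv = bounded_bilinear_matrix_vector_product[where 'n = 'n]
  obtain K where K: "K > 0" "\<forall>(C :: real^'n^'n) (D :: real^'n^'n). norm (C ** D) \<le> norm C * norm D * K"
    using bounded_bilinear.pos_bounded[OF bilin] by (elim exE conjE)
  obtain Kv where Kv: "Kv > 0" "\<forall>(C :: real^'n^'n) v. norm (C *v v) \<le> norm C * norm v * Kv"
    using bounded_bilinear.pos_bounded[OF bilinv] by (elim exE conjE)
  have "bounded (B ` {0..1})" by (intro compact_imp_bounded compact_continuous_image contB) simp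
  then obtain b where b1: "b > 0" and b2: "\<forall>v\<in>B ` {0..1}. norm v \<le> b"
    unfolding bounded_pos by (elim exE conjE)
  have b: "norm (B s) \<le> b" if "s \<in> {0..1}" for s
    using b2 that by blast
  have "\<exists>Z. Z 0 = mat 1 \<and> (\<forall>s\<in>{0..1}. (Z has_vector_derivative B s ** Z s) (at s within {0..1}))"
  proof (rule lipschitz_ode_solution_exists[of "\<lambda>s (M :: real^'n^'n). B s ** M" "b * K" "mat 1"])
    show "continuous_on ({0..1} \<times> UNIV) (\<lambda>(s, M :: real^'n^'n). B s ** M)"
    proof -
      have "continuous_on ({0..1} \<times> UNIV) (\<lambda>p :: real \<times> (real^'n^'n). B (fst p))"
        by (rule continuous_on_compose2[OF contB]) (auto intro: continuous_on_fst continuous_on_id)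
      then have "continuous_on ({0..1} \<times> UNIV) (\<lambda>p :: real \<times> (real^'n^'n). B (fst p) ** snd p)"
        by (rule bounded_bilinear.continuous_on[OF bilin _ continuous_on_snd[OF continuous_on_id]])
      then show ?thesis by (simp add: case_prod_beta)
    qed
    show "norm (B t ** M - B t ** N) \<le> b * K * norm (M - N)" if "t \<in> {0..1}" for t and M N :: "real^'n^'n"
    proof -
      have "norm (B t ** (M - N)) \<le> norm (B t) * norm (M - N) * K" by (rule K(2)[rule_format])
      also have "\<dots> \<le> b * norm (M - N) * K" using b[OF that] K(1) by (intro mult_right_mono) auto
      finally show ?thesis by (simp add: bounded_bilinear.diff_right[OF bilin] algebra_simps)
    qed
    show "0 \<le> b * K" using b1 K(1) by simp
  qed blast
  then obtain Z where Z0: "Z 0 = mat 1"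
    and Z: "\<And>s. s \<in> {0..1} \<Longrightarrow> (Z has_vector_derivative B s ** Z s) (at s within {0..1})"
    by blast

  have det: "det (Z 1) = exp (q 1 - q 0)"
  proof -
    define \<phi> where "\<phi> s = det (Z s) * exp (q 0 - q s)" for s
    have \<phi>': "(\<phi> has_real_derivative 0) (at s within {0..1})" if "s \<in> {0..1}" for s
    proof -
      have "((\<lambda>s. exp (q 0 - q s)) has_real_derivative exp (q 0 - q s) * (0 - trace (B s))) (at s within {0..1})"
        by (rule derivative_eq_intros q[OF that] refl | simp add: B_def)+
      from DERIV_mult[OF det_has_derivative_trace[OF Z[OF that]] this]
      show ?thesis by (simp add: \<phi>_def[abs_def] algebra_simps)
    qed
    have "\<phi> 1 \<le> \<phi> 0" by (rule nonpos_derivative_le_start[OF \<phi>']) simp_all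
    moreover have "- \<phi> 1 \<le> - \<phi> 0"
    proof (rule nonpos_derivative_le_start)
      show "((\<lambda>s. - \<phi> s) has_real_derivative 0) (at s within {0..1})" if "s \<in> {0..1}" for s
        using DERIV_minus[OF \<phi>'[OF that]] by simp
    qed simp_all
    ultimately have "\<phi> 1 = \<phi> 0" by simp
    then have "det (Z 1) * exp (q 0 - q 1) * exp (q 1 - q 0) = exp (q 1 - q 0)" by (simp add: \<phi>_def Z0)
    then show ?thesis by (simp add: mult.assoc exp_add[symmetric])
  qed

  \<comment> \<open>Linearisation of \<open>w s\<close> at the trajectory, uniformly in the time \<open>s\<close>.\<close>
  have linear_error: "\<exists>\<delta>>0. \<forall>s\<in>{0..1}. \<forall>y. norm (y - Y s x) < \<delta> \<longrightarrow>
      norm (w s y - w s (Y s x) - B s *v (y - Y s x)) \<le> \<epsilon> * norm (y - Y s x)" if \<epsilon>: "\<epsilon> > 0" for \<epsilon>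
  proof -
    obtain r where r: "\<And>s. s \<in> {0..1} \<Longrightarrow> norm (Y s x) \<le> r"
      using compact_imp_bounded[OF compact_continuous_image[OF contY, of x]] by (fastforce simp: bounded_iff)
    have "uniformly_continuous_on ({0..1} \<times> cball 0 (r + 1)) (\<lambda>(s, y). A s y)"
      by (intro compact_uniformly_continuous continuous_on_subset[OF contA] compact_Times) auto
    then obtain \<delta> where \<delta>: "\<delta> > 0" and unif: "\<And>s y s' y'. s \<in> {0..1} \<Longrightarrow> y \<in> cball 0 (r + 1) \<Longrightarrow> s' \<in> {0..1} \<Longrightarrow> y' \<in> cball 0 (r + 1)
        \<Longrightarrow> dist (s', y') (s, y) < \<delta> \<Longrightarrow> dist (A s' y') (A s y) < \<epsilon> / Kv"
    proof -
      assume uc: "uniformly_continuous_on ({0..1} \<times> cball 0 (r + 1)) (\<lambda>(s, y). A s y)"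
      have "\<epsilon> / Kv > 0" using Kv(1) \<epsilon> by simp
      from uniformly_continuous_onE[OF uc this] obtain \<delta> where "\<delta> > 0"
        "\<And>p p'. p \<in> {0..1} \<times> cball 0 (r + 1) \<Longrightarrow> p' \<in> {0..1} \<times> cball 0 (r + 1) \<Longrightarrow> dist p' p < \<delta> \<Longrightarrow>
          dist (case p' of (s, y) \<Rightarrow> A s y) (case p of (s, y) \<Rightarrow> A s y) < \<epsilon> / Kv" by metis
      then show ?thesis using that[of \<delta>] by fastforce
    qed
    show ?thesis
    proof (intro exI[of _ "min \<delta> 1"] conjI ballI allI impI)
      fix s y assume s: "s \<in> {0..1::real}" and y: "norm (y - Y s x) < min \<delta> 1"
      define U where "U = ball (Y s x) (min \<delta> 1)"
      \<comment> \<open>Near the trajectory, \<open>w s\<close> differs from its linear part by a function with small derivative.\<close>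
      define G where "G z = w s z - B s *v z" for z
      have Gd: "(G has_derivative (\<lambda>h. (A s z - B s) *v h)) (at z within U)" for z
      proof -
        have "(G has_derivative (\<lambda>h. A s z *v h - B s *v h)) (at z within U)"
          unfolding G_def
          by (intro has_derivative_diff has_derivative_at_withinI[OF der[OF s]]
              bounded_linear_imp_has_derivative bounded_bilinear.bounded_linear_right[OF bilinv])
        then show ?thesis by (simp add: bounded_bilinear.diff_left[OF bilinv])
      qed
      have small: "norm (A s z - B s) \<le> \<epsilon> / Kv" if "z \<in> U" for z
      proof -
        have "norm (z - Y s x) < 1" using that by (simp add: U_def dist_norm norm_minus_commute)
        then have "norm z \<le> r + 1" using r[OF s] norm_triangle_sub[of z "Y s x"] by simp
        then have "dist (A s z) (A s (Y s x)) < \<epsilon> / Kv"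
          using that r[OF s] by (intro unif s) (auto simp: U_def dist_Pair_Pair dist_commute)
        then show ?thesis by (simp add: B_def dist_norm)
      qed
      have "norm (G y - G (Y s x)) \<le> \<epsilon> * norm (y - Y s x)"
      proof (rule differentiable_bound[OF _ Gd])
        show "convex U" "Y s x \<in> U" "y \<in> U"
          using y \<delta> by (auto simp: U_def dist_norm norm_minus_commute)
        fix z assume z: "z \<in> U"
        show "onorm ((*v) (A s z - B s)) \<le> \<epsilon>"
        proof (rule onorm_bound)
          fix h
          have "norm ((A s z - B s) *v h) \<le> norm (A s z - B s) * norm h * Kv" by (rule Kv(2)[rule_format])
          also have "\<dots> \<le> (\<epsilon> / Kv) * norm h * Kv"
            using small[OF z] Kv(1) by (intro mult_right_mono) auto
          finally show "norm ((A s z - B s) *v h) \<le> \<epsilon> * norm h" using Kv(1) by simp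
        qed (use \<epsilon> in auto)
      qed
      then show "norm (w s y - w s (Y s x) - B s *v (y - Y s x)) \<le> \<epsilon> * norm (y - Y s x)"
        by (simp add: G_def bounded_bilinear.diff_right[OF bilinv] algebra_simps)
    qed (use \<delta> in auto)
  qed

  define E where "E = exp (L + 1)"
  define F where "F = exp (b * Kv + 1)"
  have EF: "E > 0" "F > 0" by (auto simp: E_def F_def)
  have "(Y 1 has_derivative (\<lambda>h. Z 1 *v h)) (at x)"
    unfolding has_derivative_at_alt
  proof (intro conjI allI impI)
    show "bounded_linear ((*v) (Z 1))" by (rule bounded_bilinear.bounded_linear_right[OF bilinv])
    fix \<epsilon> :: real assume \<epsilon>: "\<epsilon> > 0"
    then have "\<epsilon> / (E * F) > 0" using EF by simp
    from linear_error[OF this] obtain \<delta> where \<delta>: "\<delta> > 0" and lin: "\<And>s y. s \<in> {0..1} \<Longrightarrow> norm (y - Y s x) < \<delta> \<Longrightarrow>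
      norm (w s y - w s (Y s x) - B s *v (y - Y s x)) \<le> \<epsilon> / (E * F) * norm (y - Y s x)" by blast
    show "\<exists>d>0. \<forall>y. norm (y - x) < d \<longrightarrow> norm (Y 1 y - Y 1 x - Z 1 *v (y - x)) \<le> \<epsilon> * norm (y - x)"
    proof (intro exI[of _ "\<delta> / E"] conjI allI impI)
      show "\<delta> / E > 0" using \<delta> EF by simp
      fix y assume y: "norm (y - x) < \<delta> / E"
      define e where "e s = Y s y - Y s x - Z s *v (y - x)" for s
      define e' where "e' s = w s (Y s y) - w s (Y s x) - (B s ** Z s) *v (y - x)" for s
      have "norm (e 1) \<le> (norm (e 0) + \<epsilon> / (E * F) * (norm (y - x) * E)) * exp (b * Kv + 1)"
      proof (rule gronwall_norm)
        fix s :: real assume s: "s \<in> {0..1}"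
        show "(e has_vector_derivative e' s) (at s within {0..1})"
          unfolding e_def e'_def
          by (intro has_vector_derivative_diff flow s bounded_linear.has_vector_derivative[OF bounded_bilinear.bounded_linear_left[OF bilinv]] Z)
        have dist: "norm (Y s y - Y s x) \<le> norm (y - x) * E"
          using trajectories_lipschitz[where Y = Y and w = w and x = y and y = x, OF lip flow L s] by (simp add: start E_def)
        also have "\<dots> < \<delta>" using y EF by (simp add: field_simps)
        finally have "norm (w s (Y s y) - w s (Y s x) - B s *v (Y s y - Y s x)) \<le> \<epsilon> / (E * F) * norm (Y s y - Y s x)"
          by (rule lin[OF s])
        also have "\<dots> \<le> \<epsilon> / (E * F) * (norm (y - x) * E)"
          using dist \<epsilon> EF by (intro mult_left_mono) auto
        finally have 1: "norm (w s (Y s y) - w s (Y s x) - B s *v (Y s y - Y s x)) \<le> \<epsilon> / (E * F) * (norm (y - x) * E)" .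
        have 2: "norm (B s *v e s) \<le> b * Kv * norm (e s)"
        proof -
          have "norm (B s *v e s) \<le> norm (B s) * norm (e s) * Kv" by (rule Kv(2)[rule_format])
          also have "\<dots> \<le> b * norm (e s) * Kv" using b[OF s] Kv(1) by (intro mult_right_mono) auto
          finally show ?thesis by (simp add: algebra_simps)
        qed
        have "e' s = B s *v e s + (w s (Y s y) - w s (Y s x) - B s *v (Y s y - Y s x))"
          by (simp add: e'_def e_def bounded_bilinear.diff_right[OF bilinv] matrix_vector_mul_assoc[symmetric])
        then show "norm (e' s) \<le> b * Kv * norm (e s) + \<epsilon> / (E * F) * (norm (y - x) * E)"
          using 1 2 norm_triangle_ineq[of "B s *v e s"] by (smt (verit))
      qed (use b1 Kv(1) \<epsilon> EF in auto)
      also have "\<dots> = \<epsilon> * norm (y - x)"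
        using EF by (simp add: e_def start Z0 F_def[symmetric])
      finally show "norm (Y 1 y - Y 1 x - Z 1 *v (y - x)) \<le> \<epsilon> * norm (y - x)" by (simp add: e_def)
    qed
  qed
  then show ?thesis using det by (rule that)
qed

section \<open>Change of variables over arbitrary finite index types\<close>

lemma bij_betw_axis_Basis: "bij_betw (\<lambda>i. axis i 1 :: real^'n) UNIV Basis"
  unfolding bij_betw_def by (auto intro!: injI simp: axis_eq_axis Basis_vec_def)

text \<open>The theorem \<open>has_absolute_integral_change_of_variables\<close> concerns \<open>\<real>\<^sup>k\<close> with a well-ordered index
  type \<open>k\<close>. It is carried over to any finite index type by renaming the coordinates, which
  preserves Lebesgue measure and determinants.\<close>

definition permute_coords :: "('k \<Rightarrow> 'n) \<Rightarrow> real^'n \<Rightarrow> real^'k" where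
  "permute_coords \<phi> x = (\<chi> i. x $ \<phi> i)"

lemma linear_permute_coords: "linear (permute_coords \<phi>)"
  by (rule linearI) (auto simp: permute_coords_def vec_eq_iff)

lemma permute_coords_inverse:
  assumes "bij \<phi>"
  shows "permute_coords (inv \<phi>) (permute_coords \<phi> x) = x"
    and "permute_coords \<phi> (permute_coords (inv \<phi>) y) = y"
  using assms by (auto simp: permute_coords_def vec_eq_iff bij_is_surj surj_f_inv_f bij_is_inj)

lemma permute_coords_measurable: "permute_coords \<phi> \<in> borel_measurable borel"
  by (intro borel_measurable_continuous_onI linear_continuous_on)
    (simp add: linear_conv_bounded_linear[symmetric] linear_permute_coords)

lemma lborel_permute_coords:
  fixes \<phi> :: "'k::finite \<Rightarrow> 'n::finite"
  assumes \<phi>: "bij \<phi>"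
  shows "distr lborel lborel (permute_coords \<phi>) = lborel"
proof (rule lborel_eqI[symmetric])
  fix l u :: "real^'k" assume le: "\<And>b. b \<in> Basis \<Longrightarrow> l \<bullet> b \<le> u \<bullet> b"
  then have le': "l $ i \<le> u $ i" for i
    using le[of "axis i 1"] by (auto simp: inner_axis Basis_vec_def)
  define \<psi> where "\<psi> = inv \<phi>"
  have \<psi>: "bij \<psi>" "\<And>j. \<psi> (\<phi> j) = j" "\<And>i. \<phi> (\<psi> i) = i"
    using \<phi> by (auto simp: \<psi>_def bij_imp_bij_inv bij_is_inj bij_is_surj surj_f_inv_f)
  have "permute_coords \<phi> -` box l u = box (permute_coords \<psi> l) (permute_coords \<psi> u)"
    unfolding vimage_def mem_box_cart permute_coords_def
    by (auto simp: mem_box_cart) (metis \<psi>(2,3))+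
  then have "emeasure (distr lborel lborel (permute_coords \<phi>)) (box l u)
      = emeasure lborel (box (permute_coords \<psi> l) (permute_coords \<psi> u))"
    by (subst emeasure_distr) (auto simp: permute_coords_measurable)
  also have "\<dots> = (\<Prod>b\<in>Basis. (permute_coords \<psi> u - permute_coords \<psi> l) \<bullet> b)"
    using le' by (auto simp: emeasure_lborel_box_eq Basis_vec_def inner_axis permute_coords_def)
  also have "(\<Prod>b\<in>Basis. (permute_coords \<psi> u - permute_coords \<psi> l) \<bullet> b) = (\<Prod>i\<in>UNIV. u $ \<psi> i - l $ \<psi> i)"
    by (simp add: prod.reindex_bij_betw[OF bij_betw_axis_Basis, symmetric] inner_axis permute_coords_def)
  also have "\<dots> = (\<Prod>i\<in>UNIV. u $ i - l $ i)"
    by (rule prod.reindex_bij_betw[OF \<psi>(1)])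
  also have "\<dots> = (\<Prod>b\<in>Basis. (u - l) \<bullet> b)"
    by (simp add: prod.reindex_bij_betw[OF bij_betw_axis_Basis, symmetric] inner_axis)
  finally show "emeasure (distr lborel lborel (permute_coords \<phi>)) (box l u) = (\<Prod>b\<in>Basis. (u - l) \<bullet> b)" .
qed simp

text \<open>Lebesgue measurable functions need not be Borel measurable, therefore the invariance is
  passed on from Borel sets to their completion.\<close>

lemma lebesgue_permute_coords:
  fixes \<phi> :: "'k::finite \<Rightarrow> 'n::finite"
  assumes \<phi>: "bij \<phi>"
  shows "permute_coords \<phi> \<in> measurable lebesgue lebesgue"
    and "distr lebesgue lebesgue (permute_coords \<phi>) = lebesgue"
proof -
  have meas: "permute_coords \<phi> \<in> measurable lebesgue lborel"
    by (simp add: measurable_completion permute_coords_measurable)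
  have eq: "distr lebesgue lborel (permute_coords \<phi>) = lborel"
    by (subst distr_completion) (auto simp: permute_coords_measurable lborel_permute_coords[OF \<phi>])
  show "permute_coords \<phi> \<in> measurable lebesgue lebesgue"
    by (rule completion.measurable_completion2[OF meas]) (simp add: eq)
  show "distr lebesgue lebesgue (permute_coords \<phi>) = lebesgue"
    using completion.completion_distr_eq[OF meas] by (simp add: eq)
qed

lemma integral_permute_coords:
  fixes \<phi> :: "'k::finite \<Rightarrow> 'n::finite" and f :: "real^'k \<Rightarrow> real"
  assumes \<phi>: "bij \<phi>" and f: "integrable lebesgue f"
  shows "integrable lebesgue (\<lambda>x. f (permute_coords \<phi> x))"
    and "(\<integral>x. f (permute_coords \<phi> x) \<partial>lebesgue) = (\<integral>y. f y \<partial>lebesgue)"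
proof -
  have f': "f \<in> borel_measurable lebesgue" using f by simp
  show "integrable lebesgue (\<lambda>x. f (permute_coords \<phi> x))"
    using integrable_distr_eq[OF lebesgue_permute_coords(1)[OF \<phi>] f'] f
    by (simp add: lebesgue_permute_coords(2)[OF \<phi>])
  show "(\<integral>x. f (permute_coords \<phi> x) \<partial>lebesgue) = (\<integral>y. f y \<partial>lebesgue)"
    using integral_distr[OF lebesgue_permute_coords(1)[OF \<phi>] f']
    by (simp add: lebesgue_permute_coords(2)[OF \<phi>])
qed

lemma det_permute_coords:
  fixes \<phi> :: "'k::finite \<Rightarrow> 'n::finite" and M :: "real^'n^'n"
  assumes \<phi>: "bij \<phi>"
  shows "det (\<chi> i j. M $ \<phi> i $ \<phi> j) = det M"
proof -
  define c where "c p = \<phi> \<circ> p \<circ> inv \<phi>" for p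
  have c: "c p = map_permutation UNIV \<phi> p" for p
    by (simp add: c_def map_permutation_def restrict_id_def fun_eq_iff \<phi> bij_is_surj)
  have "det (\<chi> i j. M $ \<phi> i $ \<phi> j)
      = (\<Sum>p | p permutes UNIV. of_int (sign p) * (\<Prod>i\<in>UNIV. M $ \<phi> i $ \<phi> (p i)))"
    by (simp add: det_def)
  also have "\<dots> = (\<Sum>q | q permutes UNIV. of_int (sign q) * (\<Prod>i\<in>UNIV. M $ i $ q i))"
  proof (rule sum.reindex_bij_witness[where i = "\<lambda>q. inv \<phi> \<circ> q \<circ> \<phi>" and j = c])
    fix p :: "'k \<Rightarrow> 'k" assume "p \<in> {p. p permutes UNIV}"
    then have p: "p permutes UNIV" by simp
    show "inv \<phi> \<circ> c p \<circ> \<phi> = p"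
      using \<phi> by (simp add: c_def fun_eq_iff bij_is_inj)
    show "c p \<in> {q. q permutes UNIV}"
      unfolding c using map_permutation_permutes[of \<phi> UNIV UNIV p] \<phi> p by simp
    have "sign (c p) = sign p"
      unfolding c by (rule sign_map_permutation) (use \<phi> p in \<open>auto simp: bij_is_inj\<close>)
    moreover have "(\<Prod>i\<in>UNIV. M $ i $ c p i) = (\<Prod>i\<in>UNIV. M $ \<phi> i $ c p (\<phi> i))"
      by (rule prod.reindex_bij_betw[symmetric, OF \<phi>])
    ultimately show "of_int (sign (c p)) * (\<Prod>i\<in>UNIV. M $ i $ c p i)
        = of_int (sign p) * (\<Prod>i\<in>UNIV. M $ \<phi> i $ \<phi> (p i))"
      using \<phi> by (simp add: c_def bij_is_inj)
  next
    fix q :: "'n \<Rightarrow> 'n" assume "q \<in> {q. q permutes UNIV}"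
    then have q: "q permutes UNIV" by simp
    show "c (inv \<phi> \<circ> q \<circ> \<phi>) = q"
      using \<phi> by (simp add: c_def fun_eq_iff bij_is_surj surj_f_inv_f)
    have "bij (inv \<phi> \<circ> q \<circ> \<phi>)"
      by (intro bij_comp \<phi> bij_imp_bij_inv permutes_bij[OF q])
    then show "inv \<phi> \<circ> q \<circ> \<phi> \<in> {p. p permutes UNIV}"
      by (intro CollectI bij_imp_permutes) simp_all
  qed
  finally show ?thesis by (simp add: det_def)
qed

text \<open>A copy of a finite type, well-ordered by an enumeration of its elements.\<close>

typedef 'a well_ordered = "UNIV :: 'a set" by simp

instantiation well_ordered :: (finite) wellorder
begin

definition less_eq_well_ordered :: "'a well_ordered \<Rightarrow> 'a well_ordered \<Rightarrow> bool" where
  "x \<le> y \<longleftrightarrow> to_nat (Rep_well_ordered x) \<le> to_nat (Rep_well_ordered y)"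

definition less_well_ordered :: "'a well_ordered \<Rightarrow> 'a well_ordered \<Rightarrow> bool" where
  "x < y \<longleftrightarrow> to_nat (Rep_well_ordered x) < to_nat (Rep_well_ordered y)"

instance
proof
  fix P :: "'a well_ordered \<Rightarrow> bool" and a
  assume step: "\<And>x. (\<And>y. y < x \<Longrightarrow> P y) \<Longrightarrow> P x"
  show "P a"
    by (induction a rule: measure_induct_rule[where f = "\<lambda>x. to_nat (Rep_well_ordered x)"])
      (rule step, simp add: less_well_ordered_def)
qed (auto simp: less_eq_well_ordered_def less_well_ordered_def Rep_well_ordered_inject)

end

lemma bij_Rep_well_ordered: "bij Rep_well_ordered"
  by (metis UNIV_I bij_def injI Rep_well_ordered_inject surjI Abs_well_ordered_inverse)

instance well_ordered :: (finite) finite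
proof
  show "finite (UNIV :: 'a well_ordered set)"
    by (rule finite_imageD[where f = Rep_well_ordered]) (auto simp: bij_is_inj[OF bij_Rep_well_ordered])
qed

text \<open>The theorem behind this is phrased for gauge integrals of vector valued functions, so the scalar
  \<open>f\<close> is treated as a vector with one component.\<close>

lemma lebesgue_change_of_variables_wellorder:
  fixes f :: "real^'k::{finite,wellorder} \<Rightarrow> real" and g :: "real^'k::_ \<Rightarrow> real^'k::_"
  assumes der: "\<And>x. (g has_derivative (\<lambda>h. Z x *v h)) (at x)"
    and g: "bij g" and f: "integrable lebesgue f"
  shows "integrable lebesgue (\<lambda>x. f (g x) * \<bar>det (Z x)\<bar>)"
    and "(\<integral>x. f (g x) * \<bar>det (Z x)\<bar> \<partial>lebesgue) = (\<integral>y. f y \<partial>lebesgue)"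
proof -
  define F where "F y = (vec (f y) :: real^1)" for y
  have F: "F absolutely_integrable_on UNIV"
    by (rule absolutely_integrable_componentwise)
      (use f in \<open>auto simp: F_def Basis_vec_def inner_axis set_integrable_def\<close>)
  have "(\<lambda>x. \<bar>det (matrix ((*v) (Z x)))\<bar> *\<^sub>R F (g x)) absolutely_integrable_on UNIV
      \<and> integral UNIV (\<lambda>x. \<bar>det (matrix ((*v) (Z x)))\<bar> *\<^sub>R F (g x)) = integral UNIV F"
    using has_absolute_integral_change_of_variables[of UNIV g "\<lambda>x. (*v) (Z x)" F "integral UNIV F"]
      der g F by (auto simp: bij_def)
  then have G: "(\<lambda>x. \<bar>det (Z x)\<bar> *\<^sub>R F (g x)) absolutely_integrable_on UNIV"
    and eq: "integral UNIV (\<lambda>x. \<bar>det (Z x)\<bar> *\<^sub>R F (g x)) = integral UNIV F"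
    by (simp_all add: matrix_of_matrix_vector_mul)
  have lebesgue: "integrable lebesgue (\<lambda>x. H x $ 1) \<and> (\<integral>x. H x $ 1 \<partial>lebesgue) = integral UNIV H $ 1"
    if H: "H absolutely_integrable_on UNIV" for H :: "real^'k::_ \<Rightarrow> real^1"
  proof -
    have H1: "(\<lambda>x. H x $ 1) absolutely_integrable_on UNIV"
      using absolutely_integrable_linear[OF H bounded_linear_vec_nth[of 1]] by (simp add: o_def)
    have "integral UNIV (\<lambda>x. H x $ 1) = integral UNIV H $ 1"
      by (rule integral_component_eq_cart[OF set_lebesgue_integral_eq_integral(1)[OF H]])
    with H1 set_lebesgue_integral_eq_integral(2)[OF H1] show ?thesis
      by (simp add: set_integrable_def set_lebesgue_integral_def)
  qed
  show "integrable lebesgue (\<lambda>x. f (g x) * \<bar>det (Z x)\<bar>)"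
    using lebesgue[OF G] by (simp add: F_def mult.commute)
  show "(\<integral>x. f (g x) * \<bar>det (Z x)\<bar> \<partial>lebesgue) = (\<integral>y. f y \<partial>lebesgue)"
    using lebesgue[OF G] lebesgue[OF F] eq by (simp add: F_def mult.commute)
qed

lemma lebesgue_change_of_variables:
  fixes f :: "real^'n \<Rightarrow> real" and g :: "real^'n \<Rightarrow> real^'n"
  assumes der: "\<And>x. (g has_derivative (\<lambda>h. Z x *v h)) (at x)"
    and g: "bij g" and f: "integrable lebesgue f"
  shows "integrable lebesgue (\<lambda>x. f (g x) * \<bar>det (Z x)\<bar>)"
    and "(\<integral>x. f (g x) * \<bar>det (Z x)\<bar> \<partial>lebesgue) = (\<integral>y. f y \<partial>lebesgue)"
proof -
  define \<phi> :: "'n well_ordered \<Rightarrow> 'n" where "\<phi> = Rep_well_ordered"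
  define T where "T = permute_coords \<phi>"
  define S where "S = permute_coords (inv \<phi>)"
  have \<phi>: "bij \<phi>" and \<psi>: "bij (inv \<phi>)"
    by (auto simp: \<phi>_def bij_Rep_well_ordered bij_imp_bij_inv)
  have ST: "S (T x) = x" "T (S y) = y" for x y
    using permute_coords_inverse[OF \<phi>] by (auto simp: S_def T_def)
  have bl: "bounded_linear T" "bounded_linear S"
    by (simp_all add: S_def T_def linear_permute_coords linear_conv_bounded_linear[symmetric])
  define g' where "g' y = T (g (S y))" for y
  define Z' where "Z' y = (\<chi> i j. Z (S y) $ \<phi> i $ \<phi> j)" for y
  have conj: "T (M *v S h) = (\<chi> i j. M $ \<phi> i $ \<phi> j) *v h" for M h
  proof -
    have "(\<Sum>k\<in>UNIV. M $ \<phi> i $ k * h $ inv \<phi> k) = (\<Sum>j\<in>UNIV. M $ \<phi> i $ \<phi> j * h $ j)" for i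
      using sum.reindex_bij_betw[OF \<phi>, of "\<lambda>k. M $ \<phi> i $ k * h $ inv \<phi> k"] \<phi>
      by (simp add: bij_is_inj)
    then show ?thesis
      by (simp add: vec_eq_iff T_def S_def permute_coords_def matrix_vector_mult_def)
  qed
  have der': "(g' has_derivative (\<lambda>h. Z' y *v h)) (at y)" for y
  proof -
    have "((\<lambda>y. T (g (S y))) has_derivative (\<lambda>h. T (Z (S y) *v S h))) (at y)"
      by (intro bounded_linear.has_derivative[OF bl(1)] has_derivative_compose[OF _ der]
          bounded_linear_imp_has_derivative[OF bl(2)])
    then show ?thesis by (simp add: g'_def[abs_def] Z'_def conj)
  qed
  have "bij T" by (rule bij_betw_byWitness[where f' = S]) (auto simp: ST)
  moreover have "bij S" by (rule bij_betw_byWitness[where f' = T]) (auto simp: ST)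
  ultimately have "bij (T \<circ> (g \<circ> S))" by (intro bij_comp g)
  then have g'b: "bij g'" by (simp add: g'_def[abs_def] o_def)
  have f': "integrable lebesgue (\<lambda>y. f (S y))" and fe: "(\<integral>y. f (S y) \<partial>lebesgue) = (\<integral>x. f x \<partial>lebesgue)"
    unfolding S_def by (rule integral_permute_coords[OF \<psi> f])+
  note cv = lebesgue_change_of_variables_wellorder[OF der' g'b f']
  have pull: "f (S (g' (T x))) * \<bar>det (Z' (T x))\<bar> = f (g x) * \<bar>det (Z x)\<bar>" for x
    using det_permute_coords[OF \<phi>] by (simp add: g'_def Z'_def ST)
  show "integrable lebesgue (\<lambda>x. f (g x) * \<bar>det (Z x)\<bar>)"
    using integral_permute_coords(1)[OF \<phi> cv(1)] by (simp add: T_def[symmetric] pull)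
  show "(\<integral>x. f (g x) * \<bar>det (Z x)\<bar> \<partial>lebesgue) = (\<integral>y. f y \<partial>lebesgue)"
    using integral_permute_coords(2)[OF \<phi> cv(1)] cv(2) fe by (simp add: T_def[symmetric] pull)
qed

section \<open>Functions with bounded partial derivatives\<close>

lemma C_k_Suc_differentiable: "C_k (Suc k) f \<Longrightarrow> f differentiable (at x)"
  by (simp add: differentiable_on_def)

lemma C_k_continuous: "C_k k f \<Longrightarrow> continuous_on UNIV f"
  by (cases k) (auto intro: differentiable_imp_continuous_on)

lemma has_derivative_partials:
  fixes f :: "'a::euclidean_space \<Rightarrow> 'b::real_normed_vector"
  assumes "f differentiable (at x)"
  shows "(f has_derivative (\<lambda>h. \<Sum>b\<in>Basis. (h \<bullet> b) *\<^sub>R partial b f x)) (at x)"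
proof -
  have D: "(f has_derivative frechet_derivative f (at x)) (at x)"
    using assms frechet_derivative_works by blast
  then have "linear (frechet_derivative f (at x))" by (rule has_derivative_linear)
  then have "frechet_derivative f (at x) h = (\<Sum>b\<in>Basis. (h \<bullet> b) *\<^sub>R partial b f x)" for h
    unfolding partial_def by (subst euclidean_representation[of h, symmetric])
      (simp only: linear_sum linear_scale o_def)
  then have "frechet_derivative f (at x) = (\<lambda>h. \<Sum>b\<in>Basis. (h \<bullet> b) *\<^sub>R partial b f x)" by (rule ext)
  with D show ?thesis by simp
qed

lemma partial_eq_derivative: "(f has_derivative f') (at x) \<Longrightarrow> partial b f x = f' b"
  unfolding partial_def by (metis frechet_derivative_at)

lemma norm_derivative_le_partials:
  fixes f :: "'a::euclidean_space \<Rightarrow> 'b::real_normed_vector" and B :: real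
  assumes "\<And>b. b \<in> Basis \<Longrightarrow> norm (partial b f x) \<le> B"
  shows "norm (\<Sum>b\<in>Basis. (h \<bullet> b) *\<^sub>R partial b f x) \<le> DIM('a) * B * norm h"
proof -
  have "norm (\<Sum>b\<in>Basis. (h \<bullet> b) *\<^sub>R partial b f x) \<le> (\<Sum>b\<in>(Basis :: 'a set). norm h * B)"
    by (rule order_trans[OF norm_sum sum_mono])
      (auto intro!: mult_mono assms Basis_le_norm order_trans[OF norm_ge_zero assms])
  then show ?thesis by (simp add: algebra_simps)
qed

lemma lipschitz_of_bounded_partials:
  fixes f :: "'a::euclidean_space \<Rightarrow> 'b::real_normed_vector" and B :: real
  assumes diff: "\<And>x. f differentiable (at x)"
    and bd: "\<And>b x. b \<in> Basis \<Longrightarrow> norm (partial b f x) \<le> B"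
  shows "norm (f x - f y) \<le> DIM('a) * B * norm (x - y)"
proof (rule differentiable_bound[where S = UNIV])
  show "(f has_derivative (\<lambda>h. \<Sum>b\<in>Basis. (h \<bullet> b) *\<^sub>R partial b f z)) (at z within UNIV)" for z
    using has_derivative_partials[OF diff] by simp
  have "0 \<le> B" using bd[OF SOME_Basis] norm_ge_zero order_trans by blast
  then show "onorm (\<lambda>h. \<Sum>b\<in>Basis. (h \<bullet> b) *\<^sub>R partial b f z) \<le> DIM('a) * B" for z
    by (intro onorm_bound norm_derivative_le_partials bd) auto
qed auto

text \<open>The set where the bound holds is closed and has full measure, so it is the whole space.\<close>

lemma Linf_norm_bound_everywhere:
  fixes f :: "'a::euclidean_space \<Rightarrow> 'b::real_normed_vector"
  assumes cont: "continuous_on UNIV f" and fin: "Linf_norm f < \<infinity>"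
  obtains B where "\<And>x. norm (f x) \<le> B"
proof -
  obtain B where B: "Linf_norm f \<le> ereal B"
    using fin by (cases "Linf_norm f") auto
  have "AE x in lebesgue. ereal (norm (f x)) \<le> Linf_norm f"
    unfolding Linf_norm_def by (rule esssup_AE)
  then have "AE x in lebesgue. x \<in> {x. norm (f x) \<le> B}"
  proof eventually_elim
    case (elim x)
    from order_trans[OF this B] show ?case by simp
  qed
  moreover have "closed {x. norm (f x) \<le> B}"
    by (rule closed_Collect_le[OF continuous_on_norm[OF cont] continuous_on_const])
  ultimately have "x \<in> {x. norm (f x) \<le> B}" for x
    using mem_closed_if_AE_lebesgue by blast
  then show ?thesis using that by blast
qed

section \<open>Convolution with a smooth bounded kernel\<close>

lemma integrable_times_bounded:
  fixes f g :: "'a::euclidean_space \<Rightarrow> real"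
  assumes f: "integrable lebesgue f" and g: "continuous_on UNIV g" and B: "\<And>x. \<bar>g x\<bar> \<le> B"
  shows "integrable lebesgue (\<lambda>x. f x * g x)"
    and "\<bar>\<integral>x. f x * g x \<partial>lebesgue\<bar> \<le> B * (\<integral>x. \<bar>f x\<bar> \<partial>lebesgue)"
proof -
  have g_meas: "g \<in> borel_measurable lebesgue"
    by (simp add: measurable_completion borel_measurable_continuous_onI g)
  have le: "\<bar>f x * g x\<bar> \<le> B * \<bar>f x\<bar>" for x
    using mult_right_mono[OF B[of x], of "\<bar>f x\<bar>"] by (simp add: abs_mult mult.commute)
  have meas: "(\<lambda>x. f x * g x) \<in> borel_measurable lebesgue"
    by (rule borel_measurable_times[OF borel_measurable_integrable[OF f] g_meas])
  show int: "integrable lebesgue (\<lambda>x. f x * g x)"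
  proof (rule Bochner_Integration.integrable_bound[OF _ meas])
    show "integrable lebesgue (\<lambda>x. B * \<bar>f x\<bar>)" using f by simp
    have "norm (f x * g x) \<le> norm (B * \<bar>f x\<bar>)" for x
      using le[of x] by simp
    then show "AE x in lebesgue. norm (f x * g x) \<le> norm (B * \<bar>f x\<bar>)" by simp
  qed
  have "\<bar>\<integral>x. f x * g x \<partial>lebesgue\<bar> \<le> (\<integral>x. \<bar>f x * g x\<bar> \<partial>lebesgue)"
    using integral_norm_bound[of lebesgue "\<lambda>x. f x * g x"] by simp
  also have "\<dots> \<le> (\<integral>x. B * \<bar>f x\<bar> \<partial>lebesgue)"
    using int f le by (intro integral_mono) auto
  finally show "\<bar>\<integral>x. f x * g x \<partial>lebesgue\<bar> \<le> B * (\<integral>x. \<bar>f x\<bar> \<partial>lebesgue)" by simp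
qed

text \<open>Differentiation under the integral sign: the difference quotients of the kernel are dominated
  by its Lipschitz constant, so dominated convergence applies along every sequence tending to
  \<open>x\<close>.\<close>

lemma convolution_has_derivative:
  fixes f g :: "real^'n \<Rightarrow> real"
  assumes f: "integrable lebesgue f"
    and diff: "\<And>x. g differentiable (at x)" and B: "\<And>x. \<bar>g x\<bar> \<le> B"
    and cont': "\<And>b. b \<in> Basis \<Longrightarrow> continuous_on UNIV (partial b g)"
    and B': "\<And>b x. b \<in> Basis \<Longrightarrow> \<bar>partial b g x\<bar> \<le> B'"
  shows "(convolution f g has_derivative (\<lambda>h. \<Sum>b\<in>Basis. (h \<bullet> b) * convolution f (partial b g) x)) (at x)"
proof -
  have cont: "continuous_on UNIV g"
    by (intro differentiable_imp_continuous_on) (simp add: differentiable_on_def diff)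
  have shift: "continuous_on UNIV (\<lambda>\<xi>. k (y - \<xi>))" if "continuous_on UNIV k" for k :: "real^'n \<Rightarrow> real" and y
    by (rule continuous_on_compose2[OF that]) (auto intro!: continuous_intros)
  define D where "D z h = (\<Sum>b\<in>Basis. (h \<bullet> b) *\<^sub>R partial b g z)" for z h
  define L where "L = real DIM(real^'n) * B'"
  have D: "(g has_derivative D z) (at z)" for z
    unfolding D_def by (rule has_derivative_partials[OF diff])
  have DL: "\<bar>D z h\<bar> \<le> L * norm h" for z h
    using norm_derivative_le_partials[of g z B' h] B' by (simp add: D_def L_def)
  have lip: "\<bar>g y - g z\<bar> \<le> L * norm (y - z)" for y z
    using lipschitz_of_bounded_partials[OF diff, of B' y z] B' by (simp add: L_def)
  have intg: "integrable lebesgue (\<lambda>\<xi>. f \<xi> * g (y - \<xi>))" for y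
    by (rule integrable_times_bounded(1)[OF f shift[OF cont] B])
  have intD: "integrable lebesgue (\<lambda>\<xi>. f \<xi> * D (x - \<xi>) h)"
    and convD: "(\<Sum>b\<in>Basis. (h \<bullet> b) * convolution f (partial b g) x) = (\<integral>\<xi>. f \<xi> * D (x - \<xi>) h \<partial>lebesgue)" for h
  proof -
    have i': "integrable lebesgue (\<lambda>\<xi>. f \<xi> * partial b g (x - \<xi>))" if "b \<in> Basis" for b
      by (intro integrable_times_bounded(1)[OF f shift[OF cont'] B'] that)
    then have i: "integrable lebesgue (\<lambda>\<xi>. (h \<bullet> b) * (f \<xi> * partial b g (x - \<xi>)))" if "b \<in> Basis" for b
      using that by simp
    have eq: "f \<xi> * D (x - \<xi>) h = (\<Sum>b\<in>Basis. (h \<bullet> b) * (f \<xi> * partial b g (x - \<xi>)))" for \<xi>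
      by (simp add: D_def sum_distrib_left algebra_simps)
    show "integrable lebesgue (\<lambda>\<xi>. f \<xi> * D (x - \<xi>) h)"
      unfolding eq by (intro Bochner_Integration.integrable_sum i)
    show "(\<Sum>b\<in>Basis. (h \<bullet> b) * convolution f (partial b g) x) = (\<integral>\<xi>. f \<xi> * D (x - \<xi>) h \<partial>lebesgue)"
      unfolding eq convolution_def by (subst Bochner_Integration.integral_sum[OF i]) (simp_all add: i')
  qed
  \<comment> \<open>The remainder of the difference quotient of the kernel.\<close>
  define Q where "Q y \<xi> = (g (y - \<xi>) - g (x - \<xi>) - D (x - \<xi>) (y - x)) / norm (y - x)" for y \<xi>
  have Qint: "f \<xi> * Q y \<xi> = (f \<xi> * g (y - \<xi>) - f \<xi> * g (x - \<xi>) - f \<xi> * D (x - \<xi>) (y - x)) / norm (y - x)" for y \<xi>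
    by (simp add: Q_def right_diff_distrib)
  have Qle: "\<bar>Q y \<xi>\<bar> \<le> 2 * L" if "y \<noteq> x" for y \<xi>
  proof -
    have "\<bar>g (y - \<xi>) - g (x - \<xi>) - D (x - \<xi>) (y - x)\<bar> \<le> L * norm (y - x) + L * norm (y - x)"
      using lip[of "y - \<xi>" "x - \<xi>"] DL[of "x - \<xi>" "y - x"] by simp
    then show ?thesis using that by (simp add: Q_def field_simps)
  qed
  have Qlim: "((\<lambda>y. Q y \<xi>) \<longlongrightarrow> 0) (at x)" for \<xi>
  proof -
    have "((\<lambda>y. g (y - \<xi>)) has_derivative D (x - \<xi>)) (at x)"
      by (rule has_derivative_compose[OF _ D, of "\<lambda>y. y - \<xi>" "\<lambda>h. h" x UNIV, simplified])
        (auto intro!: derivative_eq_intros)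
    then have "((\<lambda>y. norm (g (y - \<xi>) - g (x - \<xi>) - D (x - \<xi>) (y - x)) / norm (y - x)) \<longlongrightarrow> 0) (at x)"
      unfolding has_derivative_iff_norm by blast
    then show ?thesis
      by (subst tendsto_norm_zero_iff[symmetric]) (simp add: Q_def)
  qed
  show ?thesis
    unfolding has_derivative_iff_norm
  proof
    show "bounded_linear (\<lambda>h. \<Sum>b\<in>Basis. (h \<bullet> b) * convolution f (partial b g) x)"
      by (intro bounded_linear_sum bounded_linear_mult_left bounded_linear_compose[OF bounded_linear_mult_left] bounded_linear_inner_left)
    show "((\<lambda>y. norm (convolution f g y - convolution f g x
          - (\<Sum>b\<in>Basis. ((y - x) \<bullet> b) * convolution f (partial b g) x)) / norm (y - x)) \<longlongrightarrow> 0) (at x)"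
      unfolding tendsto_at_iff_sequentially
    proof (intro allI impI)
      fix X assume X: "\<forall>i. X i \<in> UNIV - {x}" "X \<longlonglongrightarrow> x"
      have lim0: "(\<lambda>i. \<integral>\<xi>. f \<xi> * Q (X i) \<xi> \<partial>lebesgue) \<longlonglongrightarrow> (\<integral>(\<xi> :: real^'n). 0 \<partial>lebesgue)"
      proof (rule integral_dominated_convergence[where w = "\<lambda>\<xi>. 2 * L * \<bar>f \<xi>\<bar>"])
        show "(\<lambda>\<xi>. f \<xi> * Q (X i) \<xi>) \<in> borel_measurable lebesgue" for i
          unfolding Qint
          by (intro borel_measurable_divide borel_measurable_diff borel_measurable_const
              borel_measurable_integrable[OF intg] borel_measurable_integrable[OF intD])
        show "integrable lebesgue (\<lambda>\<xi>. 2 * L * \<bar>f \<xi>\<bar>)" using f by auto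
        show "AE \<xi> in lebesgue. norm (f \<xi> * Q (X i) \<xi>) \<le> 2 * L * \<bar>f \<xi>\<bar>" for i
        proof (rule AE_I2)
          fix \<xi>
          have "\<bar>f \<xi>\<bar> * \<bar>Q (X i) \<xi>\<bar> \<le> \<bar>f \<xi>\<bar> * (2 * L)"
            using X(1) by (intro mult_left_mono Qle) auto
          then show "norm (f \<xi> * Q (X i) \<xi>) \<le> 2 * L * \<bar>f \<xi>\<bar>" by (simp add: abs_mult mult.commute)
        qed
        show "AE \<xi> in lebesgue. (\<lambda>i. f \<xi> * Q (X i) \<xi>) \<longlonglongrightarrow> 0"
        proof (rule AE_I2)
          fix \<xi>
          have "(\<lambda>i. Q (X i) \<xi>) \<longlonglongrightarrow> 0"
            using Qlim[of \<xi>, unfolded tendsto_at_iff_sequentially] X by (auto simp: o_def)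
          from tendsto_mult_right_zero[OF this]
          show "(\<lambda>i. f \<xi> * Q (X i) \<xi>) \<longlonglongrightarrow> 0" .
        qed
      qed simp
      have "(\<integral>\<xi>. f \<xi> * Q y \<xi> \<partial>lebesgue) = (convolution f g y - convolution f g x
          - (\<Sum>b\<in>Basis. ((y - x) \<bullet> b) * convolution f (partial b g) x)) / norm (y - x)" for y
        unfolding Qint convD by (simp add: convolution_def intg intD)
      then show "((\<lambda>y. norm (convolution f g y - convolution f g x
          - (\<Sum>b\<in>Basis. ((y - x) \<bullet> b) * convolution f (partial b g) x)) / norm (y - x)) \<circ> X) \<longlonglongrightarrow> 0"
        using tendsto_norm_zero[OF lim0[simplified]] by (simp add: o_def)
    qed
  qed
qed

text \<open>Continuity in time comes from the continuity of \<open>r\<close> in \<open>L\<^sup>1\<close> and the bound on the kernel,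
  continuity in space from the Lipschitz bound on the kernel.\<close>

lemma convolution_jointly_continuous:
  fixes r :: "real \<Rightarrow> real^'n \<Rightarrow> real" and g :: "real^'n \<Rightarrow> real"
  assumes int: "\<And>t. integrable lebesgue (r t)"
    and lim: "\<And>t. ((\<lambda>s. \<integral>x. \<bar>r s x - r t x\<bar> \<partial>lebesgue) \<longlongrightarrow> 0) (at t)"
    and B: "\<And>x. \<bar>g x\<bar> \<le> B" and lip: "\<And>x y. \<bar>g x - g y\<bar> \<le> L * norm (x - y)"
  shows "continuous_on UNIV (\<lambda>(t, x). convolution (r t) g x)"
proof -
  have L0: "0 \<le> L" using order_trans[OF abs_ge_zero lip[of "axis undefined 1" 0]] by simp
  have cont: "continuous_on UNIV g"
  proof (rule lipschitz_on_continuous_on)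
    show "L-lipschitz_on UNIV g"
      using lip L0 by (auto intro!: lipschitz_onI simp: dist_norm)
  qed
  have shift: "continuous_on UNIV (\<lambda>\<xi>. g (y - \<xi>))" for y
    by (rule continuous_on_compose2[OF cont]) (auto intro!: continuous_intros)
  have intg: "integrable lebesgue (\<lambda>\<xi>. r t \<xi> * g (y - \<xi>))" for t y
    by (rule integrable_times_bounded(1)[OF int shift B])
  have "isCont (\<lambda>(t, x). convolution (r t) g x) (t, x)" for t x
  proof -
    define N where "N s = (\<integral>x. \<bar>r s x - r t x\<bar> \<partial>lebesgue)" for s
    define M where "M = (\<integral>x. \<bar>r t x\<bar> \<partial>lebesgue)"
    have "isCont N t" using lim[of t] by (simp add: isCont_def N_def[abs_def])
    then have "isCont (\<lambda>p. B * N (fst p) + L * norm (snd p - x) * M) (t, x)"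
      by (intro continuous_intros isCont_o2[of "(t, x)" fst N]) auto
    then have lim0: "((\<lambda>p. B * N (fst p) + L * norm (snd p - x) * M) \<longlongrightarrow> 0) (at (t, x))"
      by (simp add: isCont_def N_def)
    have "norm (convolution (r s) g y - convolution (r t) g x) \<le> B * N s + L * norm (y - x) * M" for s y
    proof -
      have "convolution (r s) g y - convolution (r t) g x
          = (\<integral>\<xi>. (r s \<xi> - r t \<xi>) * g (y - \<xi>) \<partial>lebesgue) + (\<integral>\<xi>. r t \<xi> * (g (y - \<xi>) - g (x - \<xi>)) \<partial>lebesgue)"
        unfolding convolution_def by (simp add: left_diff_distrib right_diff_distrib intg)
      moreover have "\<bar>\<integral>\<xi>. (r s \<xi> - r t \<xi>) * g (y - \<xi>) \<partial>lebesgue\<bar> \<le> B * N s"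
        unfolding N_def by (rule integrable_times_bounded(2)) (auto intro!: int shift B)
      moreover have "\<bar>\<integral>\<xi>. r t \<xi> * (g (y - \<xi>) - g (x - \<xi>)) \<partial>lebesgue\<bar> \<le> L * norm (y - x) * M"
        unfolding M_def
      proof (rule integrable_times_bounded(2))
        show "\<bar>g (y - \<xi>) - g (x - \<xi>)\<bar> \<le> L * norm (y - x)" for \<xi>
          using lip[of "y - \<xi>" "x - \<xi>"] by simp
      qed (auto intro!: int shift continuous_intros)
      ultimately show ?thesis by simp
    qed
    then have "((\<lambda>p. convolution (r (fst p)) g (snd p) - convolution (r t) g x) \<longlongrightarrow> 0) (at (t, x))"
      by (intro Lim_null_comparison[OF _ lim0] always_eventually) simp
    then show ?thesis
      unfolding isCont_def split_beta' by (simp add: LIM_zero_iff)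
  qed
  then show ?thesis by (auto intro!: continuous_at_imp_continuous_on)
qed

section \<open>Flows and the transport of densities\<close>

text \<open>The Lipschitz constant may depend on the time interval, since for the velocities below it is
  proportional to the mass of the density at that time.\<close>

locale lipschitz_flow =
  fixes v :: "real \<Rightarrow> real^'n \<Rightarrow> real^'n" and A :: "real \<Rightarrow> real^'n \<Rightarrow> real^'n^'n"
    and X :: "real \<Rightarrow> real \<Rightarrow> real^'n \<Rightarrow> real^'n"
  assumes flow: "is_flow UNIV v X"
    and lip: "\<And>T. \<exists>C\<ge>0. \<forall>t\<in>{-T..T}. \<forall>x y. norm (v t x - v t y) \<le> C * norm (x - y)"
    and der: "\<And>t x. (v t has_derivative (\<lambda>h. A t x *v h)) (at x)"
    and contA: "continuous_on UNIV (\<lambda>(t, x). A t x)"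
begin

lemma flow_start: "X t t x = x"
  and flow_solves: "((\<lambda>s. X s t x) has_vector_derivative v s (X s t x)) (at s)"
  using flow by (auto simp: is_flow_def)

lemma lipschitz_on_segment:
  fixes a b :: real
  obtains C where "0 \<le> C"
    "\<And>s x y. s \<in> {0..1} \<Longrightarrow> norm (v (a + s * (b - a)) x - v (a + s * (b - a)) y) \<le> C * norm (x - y)"
proof -
  define T where "T = \<bar>a\<bar> + \<bar>b - a\<bar>"
  obtain C where C: "C \<ge> 0" "\<forall>t\<in>{-T..T}. \<forall>x y. norm (v t x - v t y) \<le> C * norm (x - y)"
    using lip by blast
  have "a + s * (b - a) \<in> {-T..T}" if "s \<in> {0..1}" for s
  proof -
    have "\<bar>s * (b - a)\<bar> \<le> 1 * \<bar>b - a\<bar>"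
      unfolding abs_mult using that by (intro mult_right_mono) auto
    then show ?thesis by (auto simp: T_def)
  qed
  with C show ?thesis by (intro that[of C]) auto
qed

lemma has_vector_derivative_along_segment:
  fixes a b :: real
  assumes "\<And>r. (f has_vector_derivative f' r) (at r)"
  shows "((\<lambda>s. f (a + s * (b - a))) has_vector_derivative (b - a) *\<^sub>R f' (a + s * (b - a))) (at s within S)"
proof -
  have "((\<lambda>s. a + s * (b - a)) has_vector_derivative (b - a)) (at s within S)"
    by (auto intro!: derivative_eq_intros)
  from vector_diff_chain_within[OF this has_vector_derivative_at_within[OF assms]]
  show ?thesis by (simp add: o_def)
qed

lemma trajectory_unique:
  assumes f: "\<And>s. (f has_vector_derivative v s (f s)) (at s)"
    and g: "\<And>s. (g has_vector_derivative v s (g s)) (at s)" and start: "f a = g a"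
  shows "f b = g b"
proof -
  obtain C where C: "0 \<le> C"
    "\<And>s x y. s \<in> {0..1} \<Longrightarrow> norm (v (a + s * (b - a)) x - v (a + s * (b - a)) y) \<le> C * norm (x - y)"
    using lipschitz_on_segment[of a b] by blast
  define \<tau> where "\<tau> s = a + s * (b - a)" for s
  have "norm (f (\<tau> 1) - g (\<tau> 1)) \<le> (norm (f (\<tau> 0) - g (\<tau> 0)) + 0) * exp (\<bar>b - a\<bar> * C + 1)"
  proof (rule gronwall_norm)
    fix s :: real assume s: "s \<in> {0..1}"
    show "((\<lambda>s. f (\<tau> s) - g (\<tau> s)) has_vector_derivative
        (b - a) *\<^sub>R v (\<tau> s) (f (\<tau> s)) - (b - a) *\<^sub>R v (\<tau> s) (g (\<tau> s))) (at s within {0..1})"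
      unfolding \<tau>_def
      by (intro has_vector_derivative_diff has_vector_derivative_along_segment f g)
    show "norm ((b - a) *\<^sub>R v (\<tau> s) (f (\<tau> s)) - (b - a) *\<^sub>R v (\<tau> s) (g (\<tau> s)))
        \<le> \<bar>b - a\<bar> * C * norm (f (\<tau> s) - g (\<tau> s)) + 0"
      using mult_left_mono[OF C(2)[OF s, of "f (\<tau> s)" "g (\<tau> s)"], of "\<bar>b - a\<bar>"]
      by (simp add: \<tau>_def scaleR_diff_right[symmetric] mult.assoc)
  qed (use C in auto)
  then show ?thesis by (simp add: \<tau>_def start)
qed

lemma flow_compose: "X s r (X r t x) = X s t x"
  by (rule trajectory_unique[of "\<lambda>s. X s r (X r t x)" "\<lambda>s. X s t x" r])
    (simp_all add: flow_solves flow_start)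

lemma flow_inverse: "X t s (X s t x) = x"
  by (simp add: flow_compose flow_start)

lemma bij_flow: "bij (X s t)"
  by (rule bij_betw_byWitness[where f' = "X t s"]) (auto simp: flow_inverse)

lemma flow_continuous_time: "continuous_on UNIV (\<lambda>s. X s t x)"
  by (intro continuous_at_imp_continuous_on ballI has_vector_derivative_continuous[OF flow_solves])

lemma divergence_eq_trace: "divergence (v t) x = trace (A t x)"
proof -
  have "(A t x *v axis j 1) $ j = A t x $ j $ j" for j
    by (simp add: matrix_vector_mul_component inner_axis)
  then show ?thesis
    by (simp add: divergence_def partial_eq_derivative[OF der] trace_def)
qed

text \<open>The affine path from time \<open>a\<close> to time \<open>b\<close> turns the flow into one on \<open>[0, 1]\<close> with velocity
  \<open>(b - a) v\<close>, whatever the order of \<open>a\<close> and \<open>b\<close>.\<close>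

lemma flow_map_derivative:
  fixes a b :: real and x :: "real^'n"
  defines "G \<equiv> \<lambda>u. LBINT \<tau>=0..u. divergence (v \<tau>) (X \<tau> a x)"
  obtains Z where "(X b a has_derivative (\<lambda>h. Z *v h)) (at x)" "det Z = exp (G b - G a)"
proof -
  have contA': "continuous_on S (\<lambda>p. A (f p) (g p))" if "continuous_on S f" "continuous_on S g"
    for f g and S :: "'c::topological_space set"
  proof -
    have "continuous_on S (\<lambda>p. (f p, g p))" by (intro continuous_on_Pair that)
    from continuous_on_compose2[OF contA this] show ?thesis by simp
  qed
  have contd: "continuous_on UNIV (\<lambda>\<tau>. divergence (v \<tau>) (X \<tau> a x))"
    unfolding divergence_eq_trace trace_def
    by (intro continuous_on_sum continuous_on_component contA' continuous_on_id flow_continuous_time)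
  have G': "(G has_vector_derivative divergence (v u) (X u a x)) (at u)" for u
  proof -
    define T where "T = \<bar>u\<bar> + 1"
    have "(G has_vector_derivative divergence (v u) (X u a x)) (at u within {-T..T})"
      unfolding G_def zero_ereal_def
      by (rule interval_integral_FTC2) (auto simp: T_def intro: continuous_on_subset[OF contd])
    moreover have "at u within {-T..T} = at u"
      by (rule at_within_Icc_at) (auto simp: T_def)
    ultimately show ?thesis by (simp only:)
  qed
  define \<tau> where "\<tau> s = a + s * (b - a)" for s
  obtain C where C: "0 \<le> C"
    "\<And>s x y. s \<in> {0..1} \<Longrightarrow> norm (v (\<tau> s) x - v (\<tau> s) y) \<le> C * norm (x - y)"
    unfolding \<tau>_def using lipschitz_on_segment[of a b] by blast
  obtain Z where Z: "(X (\<tau> 1) a has_derivative (\<lambda>h. Z *v h)) (at x)" "det Z = exp (G (\<tau> 1) - G (\<tau> 0))"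
  proof (rule flow_differentiable[where Y = "\<lambda>s. X (\<tau> s) a" and w = "\<lambda>s y. (b - a) *\<^sub>R v (\<tau> s) y"
        and A = "\<lambda>s y. (b - a) *\<^sub>R A (\<tau> s) y" and q = "\<lambda>s. G (\<tau> s)" and L = "\<bar>b - a\<bar> * C" and x = x])
    fix s :: real and y z assume s: "s \<in> {0..1}"
    show "norm ((b - a) *\<^sub>R v (\<tau> s) y - (b - a) *\<^sub>R v (\<tau> s) z) \<le> \<bar>b - a\<bar> * C * norm (y - z)"
      using mult_left_mono[OF C(2)[OF s, of y z], of "\<bar>b - a\<bar>"]
      by (simp add: scaleR_diff_right[symmetric] mult.assoc)
    show "((\<lambda>y. (b - a) *\<^sub>R v (\<tau> s) y) has_derivative (\<lambda>h. ((b - a) *\<^sub>R A (\<tau> s) y) *v h)) (at y)"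
      using has_derivative_scaleR_right[OF der] by (simp add: scaleR_matrix_vector_assoc)
    show "((\<lambda>s. X (\<tau> s) a y) has_vector_derivative (b - a) *\<^sub>R v (\<tau> s) (X (\<tau> s) a y)) (at s within {0..1})"
      unfolding \<tau>_def by (rule has_vector_derivative_along_segment[OF flow_solves])
  next
    fix s :: real
    have "trace ((b - a) *\<^sub>R A (\<tau> s) (X (\<tau> s) a x)) = (b - a) * divergence (v (\<tau> s)) (X (\<tau> s) a x)"
      unfolding divergence_eq_trace by (simp add: trace_def sum_distrib_left)
    then show "((\<lambda>s. G (\<tau> s)) has_real_derivative trace ((b - a) *\<^sub>R A (\<tau> s) (X (\<tau> s) a x))) (at s within {0..1})"
      using has_vector_derivative_along_segment[OF G', of a b s "{0..1}"]
      by (simp add: has_real_derivative_iff_has_vector_derivative \<tau>_def)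
    show "continuous_on ({0..1} \<times> UNIV) (\<lambda>(s, y). (b - a) *\<^sub>R A (\<tau> s) y)"
      unfolding split_beta' \<tau>_def by (intro continuous_on_scaleR contA' continuous_intros)
  qed (use C in \<open>auto simp: \<tau>_def flow_start\<close>)
  then show ?thesis by (intro that[of Z]) (auto simp: \<tau>_def)
qed

lemma flow_continuous_space: "continuous_on UNIV (X b a)"
proof (intro continuous_at_imp_continuous_on ballI)
  fix x
  obtain Z where "(X b a has_derivative (\<lambda>h. Z *v h)) (at x)"
    by (rule flow_map_derivative[of b a x]) blast
  then show "isCont (X b a) x" by (rule has_derivative_continuous)
qed

text \<open>The exponential in the Lagrangian formula is the Jacobian determinant of the map that leads
  back to time \<open>0\<close>, so the density is the image of the datum under the flow.\<close>

lemma lagrangian_pushforward: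
  fixes r\<^sub>o k :: "real^'n \<Rightarrow> real"
  assumes r\<^sub>o: "integrable lebesgue r\<^sub>o"
    and r: "\<And>x. r x = r\<^sub>o (X 0 t x) * exp (- (LBINT \<tau>=0..t. divergence (v \<tau>) (X \<tau> t x)))"
    and k: "continuous_on UNIV k" "\<And>x. \<bar>k x\<bar> \<le> B"
  shows "(\<integral>x. r x * k x \<partial>lebesgue) = (\<integral>y. r\<^sub>o y * k (X t 0 y) \<partial>lebesgue)"
proof -
  have "\<exists>Z. (X 0 t has_derivative (\<lambda>h. Z *v h)) (at x) \<and>
      \<bar>det Z\<bar> = exp (- (LBINT \<tau>=0..t. divergence (v \<tau>) (X \<tau> t x)))" for x
    by (rule flow_map_derivative[of 0 t x]) (auto simp: zero_ereal_def[symmetric])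
  then obtain Z where Z: "\<And>x. (X 0 t has_derivative (\<lambda>h. Z x *v h)) (at x)"
    "\<And>x. \<bar>det (Z x)\<bar> = exp (- (LBINT \<tau>=0..t. divergence (v \<tau>) (X \<tau> t x)))"
    by metis
  have int: "integrable lebesgue (\<lambda>y. r\<^sub>o y * k (X t 0 y))"
    by (rule integrable_times_bounded(1)[OF r\<^sub>o continuous_on_compose2[OF k(1) flow_continuous_space] k(2)]) simp
  have "r\<^sub>o (X 0 t x) * k (X t 0 (X 0 t x)) * \<bar>det (Z x)\<bar> = r x * k x" for x
    by (simp add: Z r flow_inverse)
  with lebesgue_change_of_variables(2)[OF Z(1) bij_flow int] show ?thesis by simp
qed

end

section \<open>The nonlocal velocity\<close>

lemma sum_Basis_inner_Basis:
  fixes F :: "'a::euclidean_space \<Rightarrow> real"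
  assumes "b \<in> Basis"
  shows "(\<Sum>c\<in>Basis. (b \<bullet> c) * F c) = F b"
  using assms by (simp add: inner_Basis if_distrib[of "\<lambda>u. u * _"] cong: if_cong)

lemma norm_matrix_le_entries:
  fixes M :: "real^'m^'n"
  assumes "\<And>j i. \<bar>M $ j $ i\<bar> \<le> c"
  shows "norm M \<le> real CARD('n) * (real CARD('m) * c)"
proof -
  have row: "norm (M $ j) \<le> real CARD('m) * c" for j
  proof -
    have "norm (M $ j) \<le> (\<Sum>i\<in>UNIV. \<bar>M $ j $ i\<bar>)" by (rule norm_le_l1_cart)
    also have "\<dots> \<le> (\<Sum>i\<in>(UNIV :: 'm set). c)" by (rule sum_mono) (rule assms)
    finally show ?thesis by simp
  qed
  have "norm M \<le> (\<Sum>j\<in>UNIV. norm (M $ j))"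
    unfolding norm_vec_def by (rule L2_set_le_sum) simp
  also have "\<dots> \<le> (\<Sum>j\<in>(UNIV :: 'n set). real CARD('m) * c)" by (rule sum_mono) (rule row)
  finally show ?thesis by simp
qed

lemma norm_column_le:
  fixes M :: "real^'m^'n"
  shows "norm (column i M) \<le> norm M"
proof -
  have "norm (column i M) = L2_set (\<lambda>j. norm (M $ j $ i)) UNIV"
    by (simp add: norm_vec_def column_def)
  also have "\<dots> \<le> L2_set (\<lambda>j. norm (M $ j)) UNIV"
    by (rule L2_set_mono) (simp_all add: component_le_norm_cart)
  finally show ?thesis by (simp only: norm_vec_def[of M])
qed

lemma column_diff: "column i (M - N :: real^'m^'n) = column i M - column i N"
  by (simp add: column_def vec_eq_iff)

lemma bounded_linear_column: "bounded_linear (column i :: real^'m^'n \<Rightarrow> real^'n)"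
  by (rule bounded_linear_intro[where K = 1])
    (auto simp: column_def vec_eq_iff intro: order_trans[OF norm_column_le[unfolded column_def]])

lemma C_k_iterated_partial_continuous:
  "C_k k f \<Longrightarrow> set bs \<subseteq> Basis \<Longrightarrow> length bs \<le> k \<Longrightarrow> continuous_on UNIV (iterated_partial bs f)"
proof (induction bs arbitrary: k f)
  case Nil then show ?case by (simp add: C_k_continuous)
next
  case (Cons b bs)
  then obtain k' where "k = Suc k'" by (cases k) auto
  with Cons show ?case by auto
qed

text \<open>The regularity assumptions on \<open>V\<close> and \<open>\<eta>\<close>, in the form of pointwise bounds: the
  derivatives are continuous, so their essential bounds hold everywhere.\<close>

locale nonlocal_velocity =
  fixes V :: "real^'m^'n \<Rightarrow> real^'m^'n" and \<eta> :: "real^'n \<Rightarrow> real" and L B :: real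
  assumes eta_C3: "C_k 3 \<eta>"
    and eta_bound: "\<And>bs x. set bs \<subseteq> Basis \<Longrightarrow> length bs \<le> 3 \<Longrightarrow> \<bar>iterated_partial bs \<eta> x\<bar> \<le> B"
    and V_differentiable: "\<And>W. V differentiable (at W)"
    and V_partial_continuous: "\<And>b. b \<in> Basis \<Longrightarrow> continuous_on UNIV (partial b V)"
    and V_lipschitz: "\<And>W W'. norm (V W - V W') \<le> L * norm (W - W')"
    and L_nonneg: "0 \<le> L" and V_zero: "V 0 = 0"

lemma assumptions_imp_nonlocal_velocity:
  fixes V :: "real^'m^'n \<Rightarrow> real^'m^'n" and \<eta> :: "real^'n \<Rightarrow> real"
  assumes V: "assumption_V V" and \<eta>: "assumption_eta \<eta>"
  obtains L B where "nonlocal_velocity V \<eta> L B"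
proof -
  define S :: "(real^'n) list set" where "S = {bs. set bs \<subseteq> Basis \<and> length bs \<le> 3}"
  have "finite S" unfolding S_def by (rule finite_lists_length_le) simp
  have "\<exists>c. \<forall>x. \<bar>iterated_partial bs \<eta> x\<bar> \<le> c" if "bs \<in> S" for bs
  proof -
    have "continuous_on UNIV (iterated_partial bs \<eta>)" "Linf_norm (iterated_partial bs \<eta>) < \<infinity>"
      using \<eta> that C_k_iterated_partial_continuous[of 3 \<eta> bs]
      by (auto simp: assumption_eta_def W_k_inf_def S_def)
    from Linf_norm_bound_everywhere[OF this] show ?thesis by (metis real_norm_def)
  qed
  then obtain c where c: "\<And>bs x. bs \<in> S \<Longrightarrow> \<bar>iterated_partial bs \<eta> x\<bar> \<le> c bs" by metis
  define B where "B = (\<Sum>bs\<in>S. \<bar>c bs\<bar>)"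
  have B: "\<bar>iterated_partial bs \<eta> x\<bar> \<le> B" if "bs \<in> S" for bs x
  proof -
    have "\<bar>c bs\<bar> \<le> B" unfolding B_def by (rule member_le_sum) (use that \<open>finite S\<close> in auto)
    with c[OF that, of x] show ?thesis by linarith
  qed
  have "C_k (Suc (Suc 0)) V" using V by (simp add: assumption_V_def numeral_2_eq_2)
  then have diff: "V differentiable (at W)" and Vp: "b \<in> Basis \<Longrightarrow> continuous_on UNIV (partial b V)" for W b
    by (auto simp: differentiable_on_def intro!: differentiable_imp_continuous_on)
  have cont: "continuous_on UNIV (total_deriv V)"
    unfolding total_deriv_def by (intro continuous_on_vec_lambda Vp) (auto simp: Basis_vec_def)
  obtain l where "Linf_norm (total_deriv V) + Linf_norm (total_deriv (total_deriv V)) \<le> ereal l"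
    using V by (auto simp: assumption_V_def)
  then have "Linf_norm (total_deriv V) < \<infinity>" by (cases "Linf_norm (total_deriv V)") auto
  from Linf_norm_bound_everywhere[OF cont this] obtain l where l: "\<And>W. norm (total_deriv V W) \<le> l" by blast
  have "norm (partial b V W) \<le> l" if basis: "b \<in> Basis" for b W
  proof -
    obtain j i where b: "b = axis j (axis i 1)" using basis by (auto simp: Basis_vec_def)
    have "norm (partial b V W) = norm (total_deriv V W $ j $ i)" by (simp add: b total_deriv_def)
    also have "\<dots> \<le> norm (total_deriv V W)"
      by (rule order_trans[OF Finite_Cartesian_Product.norm_nth_le Finite_Cartesian_Product.norm_nth_le])
    finally show ?thesis using l[of W] by linarith
  qed
  then have "norm (V W - V W') \<le> (DIM(real^'m^'n) * l) * norm (W - W')" for W W'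
    by (rule lipschitz_of_bounded_partials[OF diff])
  moreover have "0 \<le> l" using l[of 0] norm_ge_zero order_trans by blast
  ultimately have "nonlocal_velocity V \<eta> (DIM(real^'m^'n) * l) B"
    using V \<eta> B diff Vp by unfold_locales (auto simp: S_def assumption_V_def assumption_eta_def)
  then show ?thesis by (rule that)
qed

context nonlocal_velocity
begin

abbreviation K :: "'n \<Rightarrow> real^'n \<Rightarrow> real" where
  "K j \<equiv> partial (axis j 1) \<eta>"

lemma B_nonneg: "0 \<le> B"
  using order_trans[OF abs_ge_zero eta_bound[of "[]"]] by simp

lemma eta_differentiable: "\<eta> differentiable (at x)"
  and K_C2: "C_k (Suc (Suc 0)) (K j)"
  using eta_C3 by (auto simp: numeral_3_eq_3 differentiable_on_def)

lemma K_differentiable: "K j differentiable (at x)"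
  and K_partial_differentiable: "b \<in> Basis \<Longrightarrow> partial b (K j) differentiable (at x)"
  using K_C2[of j] by (auto simp: differentiable_on_def)

lemma eta_partial_continuous: "b \<in> Basis \<Longrightarrow> continuous_on UNIV (partial b \<eta>)"
  and K_continuous: "continuous_on UNIV (K j)"
  and K_partial_continuous: "b \<in> Basis \<Longrightarrow> continuous_on UNIV (partial b (K j))"
  using eta_C3 by (auto simp: numeral_3_eq_3 intro!: differentiable_imp_continuous_on)

lemma eta_le: "\<bar>\<eta> x\<bar> \<le> B"
  and eta_partial_le: "b \<in> Basis \<Longrightarrow> \<bar>partial b \<eta> x\<bar> \<le> B"
  and K_le: "\<bar>K j x\<bar> \<le> B"
  and K_partial_le: "b \<in> Basis \<Longrightarrow> \<bar>partial b (K j) x\<bar> \<le> B"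
  and K_second_partial_le: "b \<in> Basis \<Longrightarrow> c \<in> Basis \<Longrightarrow> \<bar>partial c (partial b (K j)) x\<bar> \<le> B"
  using eta_bound[of "[]" x] eta_bound[of "[b]" x] eta_bound[of "[axis j 1]" x]
    eta_bound[of "[axis j 1, b]" x] eta_bound[of "[axis j 1, b, c]" x]
  by simp_all

lemma K_lipschitz: "\<bar>K j x - K j y\<bar> \<le> real CARD('n) * B * norm (x - y)"
  using lipschitz_of_bounded_partials[OF K_differentiable, where B = B] K_partial_le by simp

lemma K_partial_lipschitz:
  "b \<in> Basis \<Longrightarrow> \<bar>partial b (K j) x - partial b (K j) y\<bar> \<le> real CARD('n) * B * norm (x - y)"
  using lipschitz_of_bounded_partials[OF K_partial_differentiable, where B = B] K_second_partial_le by simp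

text \<open>The gradient falls on the kernel, so that integrability of \<open>r\<close> is enough.\<close>

lemma grad_conv_entry:
  assumes "integrable lebesgue (\<lambda>\<xi>. r \<xi> $ i)"
  shows "grad_conv r \<eta> x $ j $ i = convolution (\<lambda>\<xi>. r \<xi> $ i) (K j) x"
proof -
  note D = convolution_has_derivative[OF assms eta_differentiable eta_le eta_partial_continuous eta_partial_le]
  show ?thesis
    using partial_eq_derivative[OF D, of "axis j 1"]
    by (simp add: grad_conv_def sum_Basis_inner_Basis)
qed

end

text \<open>The velocity field generated by a density that is continuous in time with values in \<open>L\<^sup>1\<close>.\<close>

locale nonlocal_field = nonlocal_velocity V \<eta> L B
  for V :: "real^'m^'n \<Rightarrow> real^'m^'n" and \<eta> L B +
  fixes \<rho> :: "real \<Rightarrow> real^'n \<Rightarrow> real^'m"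
  assumes continuous_in_L1: "C0_L1 UNIV \<rho>"
begin

lemma integrable_density: "integrable lebesgue (\<rho> t)"
  using continuous_in_L1 by (simp add: C0_L1_def)

lemma integrable_component: "integrable lebesgue (\<lambda>x. \<rho> t x $ i)"
  by (rule integrable_bounded_linear[OF bounded_linear_vec_nth integrable_density])

lemma density_distance_tendsto: "((\<lambda>s. \<integral>x. norm (\<rho> s x - \<rho> t x) \<partial>lebesgue) \<longlongrightarrow> 0) (at t)"
  using continuous_in_L1 by (simp add: C0_L1_def)

lemma component_distance_tendsto: "((\<lambda>s. \<integral>x. \<bar>\<rho> s x $ i - \<rho> t x $ i\<bar> \<partial>lebesgue) \<longlongrightarrow> 0) (at t)"
proof (rule Lim_null_comparison[OF always_eventually density_distance_tendsto], rule allI)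
  fix s
  have "(\<integral>x. \<bar>\<rho> s x $ i - \<rho> t x $ i\<bar> \<partial>lebesgue) \<le> (\<integral>x. norm (\<rho> s x - \<rho> t x) \<partial>lebesgue)"
    using component_le_norm_cart[of "\<rho> s x - \<rho> t x" i for x]
    by (intro integral_mono integrable_norm integrable_abs Bochner_Integration.integrable_diff
        integrable_component integrable_density) simp
  then show "norm (\<integral>x. \<bar>\<rho> s x $ i - \<rho> t x $ i\<bar> \<partial>lebesgue) \<le> (\<integral>x. norm (\<rho> s x - \<rho> t x) \<partial>lebesgue)"
    by simp
qed

text \<open>The mass is continuous in time, hence bounded on compact time intervals.\<close>

lemma component_mass_locally_bounded:
  obtains M where "0 \<le> M" "\<And>t i. t \<in> {-T..T} \<Longrightarrow> (\<integral>x. \<bar>\<rho> t x $ i\<bar> \<partial>lebesgue) \<le> M"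
proof -
  define m where "m t = (\<integral>x. norm (\<rho> t x) \<partial>lebesgue)" for t
  have "(m \<longlongrightarrow> m t) (at t)" for t
  proof (rule Lim_transform2[OF tendsto_const], rule Lim_null_comparison[OF always_eventually density_distance_tendsto], rule allI)
    fix s
    have i: "integrable lebesgue (\<lambda>x. norm (\<rho> u x))" for u
      by (intro integrable_norm integrable_density)
    have j: "integrable lebesgue (\<lambda>x. norm (\<rho> s x - \<rho> t x))"
      by (intro integrable_norm Bochner_Integration.integrable_diff integrable_density)
    have "m t \<le> (\<integral>x. norm (\<rho> s x) + norm (\<rho> s x - \<rho> t x) \<partial>lebesgue)"
      unfolding m_def
      by (intro integral_mono Bochner_Integration.integrable_add i j) (metis norm_minus_commute norm_triangle_sub)
    moreover have "m s \<le> (\<integral>x. norm (\<rho> t x) + norm (\<rho> s x - \<rho> t x) \<partial>lebesgue)"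
      unfolding m_def
      by (intro integral_mono Bochner_Integration.integrable_add i j) (rule norm_triangle_sub)
    ultimately show "norm (m t - m s) \<le> (\<integral>x. norm (\<rho> s x - \<rho> t x) \<partial>lebesgue)"
      using i j by (simp add: m_def abs_le_iff)
  qed
  then have "continuous_on {-T..T} m"
    by (intro continuous_at_imp_continuous_on) (auto simp: isCont_def)
  then have "bounded (m ` {-T..T})"
    by (intro compact_imp_bounded compact_continuous_image) auto
  then obtain M where M: "M > 0" "\<forall>u\<in>m ` {-T..T}. norm u \<le> M"
    unfolding bounded_pos by blast
  show ?thesis
  proof (rule that[of M])
    fix t i assume t: "t \<in> {-T..T}"
    have "(\<integral>x. \<bar>\<rho> t x $ i\<bar> \<partial>lebesgue) \<le> m t"
      unfolding m_def
      by (intro integral_mono integrable_norm integrable_abs integrable_component integrable_density component_le_norm_cart)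
    also have "norm (m t) \<le> M" using M(2) t by blast
    then have "m t \<le> M" by simp
    finally show "(\<integral>x. \<bar>\<rho> t x $ i\<bar> \<partial>lebesgue) \<le> M" .
  qed (use M in auto)
qed

definition U :: "real \<Rightarrow> real^'n \<Rightarrow> real^'m^'n" where
  "U t x = grad_conv (\<rho> t) \<eta> x"

lemma U_entry: "U t x $ j $ i = (\<integral>\<xi>. \<rho> t \<xi> $ i * K j (x - \<xi>) \<partial>lebesgue)"
  unfolding U_def grad_conv_entry[OF integrable_component] convolution_def ..

lemma velocity_eq: "velocity V \<eta> \<rho> i t x = column i (V (U t x))"
  by (simp add: velocity_def U_def)

lemma K_shift_continuous: "continuous_on UNIV (\<lambda>\<xi>. K j (x - \<xi>))"
  by (rule continuous_on_compose2[OF K_continuous]) (auto intro!: continuous_intros)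

text \<open>The constant contains the mass of the density, which is why it is local in time.\<close>

lemma velocity_lipschitz:
  obtains C where "0 \<le> C"
    "\<And>t x y i. t \<in> {-T..T} \<Longrightarrow> norm (velocity V \<eta> \<rho> i t x - velocity V \<eta> \<rho> i t y) \<le> C * norm (x - y)"
proof -
  obtain M where M: "0 \<le> M" "\<And>t i. t \<in> {-T..T} \<Longrightarrow> (\<integral>x. \<bar>\<rho> t x $ i\<bar> \<partial>lebesgue) \<le> M"
    by (rule component_mass_locally_bounded[of T]) blast
  define C where "C = real CARD('n) * (real CARD('m) * (real CARD('n) * B * M))"
  show ?thesis
  proof (rule that[of "L * C"])
    show "0 \<le> L * C" using L_nonneg B_nonneg M by (simp add: C_def)
    fix t x y i assume t: "t \<in> {-T..T}"
    have "\<bar>(U t x - U t y) $ j $ k\<bar> \<le> real CARD('n) * B * norm (x - y) * M" for j k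
    proof -
      have "(U t x - U t y) $ j $ k = (\<integral>\<xi>. \<rho> t \<xi> $ k * (K j (x - \<xi>) - K j (y - \<xi>)) \<partial>lebesgue)"
        using integrable_times_bounded(1)[OF integrable_component K_shift_continuous K_le]
        by (simp add: U_entry right_diff_distrib)
      also have "\<bar>\<dots>\<bar> \<le> real CARD('n) * B * norm (x - y) * (\<integral>\<xi>. \<bar>\<rho> t \<xi> $ k\<bar> \<partial>lebesgue)"
      proof (rule integrable_times_bounded(2)[OF integrable_component])
        show "\<bar>K j (x - \<xi>) - K j (y - \<xi>)\<bar> \<le> real CARD('n) * B * norm (x - y)" for \<xi>
          using K_lipschitz[of j "x - \<xi>" "y - \<xi>"] by simp
      qed (intro continuous_on_diff K_shift_continuous)
      also have "\<dots> \<le> real CARD('n) * B * norm (x - y) * M"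
        using B_nonneg M(2)[OF t] by (intro mult_left_mono) auto
      finally show ?thesis .
    qed
    from norm_matrix_le_entries[OF this] have U: "norm (U t x - U t y) \<le> C * norm (x - y)"
      by (simp add: C_def mult_ac)
    have "norm (velocity V \<eta> \<rho> i t x - velocity V \<eta> \<rho> i t y) \<le> norm (V (U t x) - V (U t y))"
      unfolding velocity_eq column_diff[symmetric] by (rule norm_column_le)
    also have "\<dots> \<le> L * norm (U t x - U t y)" by (rule V_lipschitz)
    also have "\<dots> \<le> L * (C * norm (x - y))" by (rule mult_left_mono[OF U L_nonneg])
    finally show "norm (velocity V \<eta> \<rho> i t x - velocity V \<eta> \<rho> i t y) \<le> L * C * norm (x - y)"
      by (simp add: mult.assoc)
  qed
qed

definition DU :: "real \<Rightarrow> real^'n \<Rightarrow> real^'n \<Rightarrow> real^'m^'n" where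
  "DU t x h = (\<chi> j i. \<Sum>b\<in>Basis. (h \<bullet> b) * convolution (\<lambda>\<xi>. \<rho> t \<xi> $ i) (partial b (K j)) x)"

lemma U_has_derivative: "(U t has_derivative DU t x) (at x)"
proof -
  have entry: "((\<lambda>x. U t x $ j $ i) has_derivative (\<lambda>h. DU t x h $ j $ i)) (at x)" for j i
  proof -
    have "(\<lambda>x. U t x $ j $ i) = convolution (\<lambda>\<xi>. \<rho> t \<xi> $ i) (K j)"
      by (simp add: fun_eq_iff U_entry convolution_def)
    then show ?thesis
      using convolution_has_derivative[OF integrable_component K_differentiable K_le K_partial_continuous K_partial_le]
      by (simp add: DU_def)
  qed
  show ?thesis
    unfolding has_derivative_componentwise_within[of "U t"]
  proof
    fix b :: "real^'m^'n" assume "b \<in> Basis"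
    then obtain j i where b: "b = axis j (axis i 1)" by (auto simp: Basis_vec_def)
    show "((\<lambda>x. U t x \<bullet> b) has_derivative (\<lambda>h. DU t x h \<bullet> b)) (at x)"
      using entry by (simp add: b inner_axis)
  qed
qed

text \<open>The entries given by the chain rule, written out so that their joint continuity in time and
  space can be read off.\<close>

definition velocity_jacobian :: "'m \<Rightarrow> real \<Rightarrow> real^'n \<Rightarrow> real^'n^'n" where
  "velocity_jacobian i t x =
     (\<chi> a k. \<Sum>b\<in>Basis. (DU t x (axis k 1) \<bullet> b) * (partial b V (U t x) $ a $ i))"

lemma velocity_has_derivative:
  "(velocity V \<eta> \<rho> i t has_derivative (\<lambda>h. velocity_jacobian i t x *v h)) (at x)"
proof -
  define D where "D h = column i (\<Sum>b\<in>Basis. (DU t x h \<bullet> b) *\<^sub>R partial b V (U t x))" for h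
  have D: "(velocity V \<eta> \<rho> i t has_derivative D) (at x)"
    unfolding D_def velocity_eq[abs_def]
    by (intro bounded_linear.has_derivative[OF bounded_linear_column]
        has_derivative_compose[OF U_has_derivative has_derivative_partials[OF V_differentiable]])
  have "matrix D = velocity_jacobian i t x"
    by (simp add: matrix_def velocity_jacobian_def D_def column_def)
  then have "D = (\<lambda>h. velocity_jacobian i t x *v h)"
    using matrix_vector_mul(2)[OF has_derivative_linear[OF D]] by simp
  with D show ?thesis by simp
qed

lemma velocity_jacobian_continuous: "continuous_on UNIV (\<lambda>(t, x). velocity_jacobian i t x)"
proof -
  have U_cont: "continuous_on UNIV (\<lambda>p. U (fst p) (snd p))"
  proof -
    have "continuous_on UNIV (\<lambda>p. U (fst p) (snd p) $ j $ i)" for j i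
      using convolution_jointly_continuous[of "\<lambda>t \<xi>. \<rho> t \<xi> $ i" "K j", OF integrable_component component_distance_tendsto K_le K_lipschitz]
      by (simp add: split_beta' U_entry convolution_def)
    then have "continuous_on UNIV (\<lambda>p. \<chi> j i. U (fst p) (snd p) $ j $ i)"
      by (intro continuous_on_vec_lambda)
    then show ?thesis by simp
  qed
  have DU_cont: "continuous_on UNIV (\<lambda>p. DU (fst p) (snd p) h)" for h
  proof -
    have "continuous_on UNIV (\<lambda>p. convolution (\<lambda>\<xi>. \<rho> (fst p) \<xi> $ i) (partial b (K j)) (snd p))"
      if "b \<in> Basis" for b j i
      using convolution_jointly_continuous[of "\<lambda>t \<xi>. \<rho> t \<xi> $ i" "partial b (K j)",
          OF integrable_component component_distance_tendsto K_partial_le[OF that] K_partial_lipschitz[OF that]]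
      by (simp add: split_beta')
    then show ?thesis
      unfolding DU_def
      by (intro continuous_on_vec_lambda continuous_on_sum continuous_on_mult continuous_on_const)
  qed
  have "continuous_on UNIV (\<lambda>p. partial b V (U (fst p) (snd p)) $ a $ i)" if "b \<in> Basis" for b a
    by (intro continuous_on_component continuous_on_compose2[OF V_partial_continuous[OF that] U_cont]) simp
  then show ?thesis
    unfolding split_beta' velocity_jacobian_def
    by (intro continuous_on_vec_lambda continuous_on_sum continuous_on_mult continuous_on_inner
        continuous_on_const DU_cont)
qed

lemma velocity_lipschitz_flow:
  assumes "is_flow UNIV (velocity V \<eta> \<rho> i) X"
  shows "lipschitz_flow (velocity V \<eta> \<rho> i) (velocity_jacobian i) X"
proof
  show "\<exists>C\<ge>0. \<forall>t\<in>{-T..T}. \<forall>x y. norm (velocity V \<eta> \<rho> i t x - velocity V \<eta> \<rho> i t y) \<le> C * norm (x - y)" for T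
    by (rule velocity_lipschitz[of T]) blast
qed (fact assms velocity_has_derivative velocity_jacobian_continuous)+

end

section \<open>The mean-field system for the characteristics\<close>

context nonlocal_velocity
begin

text \<open>The matrix \<open>\<nabla>\<rho> * \<eta>\<close> at \<open>x\<close>, if the mass that \<open>m\<close> puts at \<open>y\<close> has been carried to \<open>Y i y\<close>.\<close>

definition mean_field :: "(real^'n \<Rightarrow> real^'m) \<Rightarrow> ('m \<Rightarrow> real^'n \<Rightarrow> real^'n) \<Rightarrow> real^'n \<Rightarrow> real^'m^'n" where
  "mean_field m Y x = (\<chi> j i. \<integral>y. m y $ i * K j (x - Y i y) \<partial>lebesgue)"

lemma K_displacement_continuous:
  "continuous_on UNIV (Y :: real^'n \<Rightarrow> real^'n) \<Longrightarrow> continuous_on UNIV (\<lambda>y. K j (x - Y y))"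
  by (rule continuous_on_compose2[OF K_continuous]) (auto intro!: continuous_intros)

lemma mean_field_bound:
  assumes m: "\<And>i. integrable lebesgue (\<lambda>y. m y $ i)" and M: "\<And>i. (\<integral>y. \<bar>m y $ i\<bar> \<partial>lebesgue) \<le> M"
    and Y: "\<And>i. continuous_on UNIV (Y i)"
  shows "norm (V (mean_field m Y x)) \<le> L * (real CARD('n) * (real CARD('m) * (B * M)))"
proof -
  have "\<bar>mean_field m Y x $ j $ i\<bar> \<le> B * M" for j i
  proof -
    have "\<bar>mean_field m Y x $ j $ i\<bar> \<le> B * (\<integral>y. \<bar>m y $ i\<bar> \<partial>lebesgue)"
      unfolding mean_field_def vec_lambda_beta
      by (rule integrable_times_bounded(2)[OF m K_displacement_continuous[OF Y] K_le])
    also have "\<dots> \<le> B * M" by (rule mult_left_mono[OF M B_nonneg])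
    finally show ?thesis .
  qed
  note F = norm_matrix_le_entries[OF this]
  have "norm (V (mean_field m Y x) - V 0) \<le> L * norm (mean_field m Y x - 0)" by (rule V_lipschitz)
  also have "\<dots> \<le> L * (real CARD('n) * (real CARD('m) * (B * M)))"
    using mult_left_mono[OF F L_nonneg] by simp
  finally show ?thesis by (simp add: V_zero)
qed

lemma mean_field_lipschitz:
  assumes m: "\<And>i. integrable lebesgue (\<lambda>y. m y $ i)" and M: "\<And>i. (\<integral>y. \<bar>m y $ i\<bar> \<partial>lebesgue) \<le> M"
    and Y: "\<And>i. continuous_on UNIV (Y i)" and Z: "\<And>i. continuous_on UNIV (Z i)"
    and d: "\<And>i y. norm (Y i y - Z i y) \<le> d"
  shows "norm (V (mean_field m Y x) - V (mean_field m Z z))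
    \<le> L * (real CARD('n) * (real CARD('m) * (real CARD('n) * B * (norm (x - z) + d) * M)))"
proof -
  have "\<bar>(mean_field m Y x - mean_field m Z z) $ j $ i\<bar> \<le> real CARD('n) * B * (norm (x - z) + d) * M" for j i
  proof -
    have K_diff: "\<bar>K j (x - Y i y) - K j (z - Z i y)\<bar> \<le> real CARD('n) * B * (norm (x - z) + d)" for y
    proof -
      have "norm ((x - Y i y) - (z - Z i y)) \<le> norm (x - z) + norm (Y i y - Z i y)"
        using norm_triangle_ineq4[of "x - z" "Y i y - Z i y"] by (simp add: algebra_simps)
      then have "norm ((x - Y i y) - (z - Z i y)) \<le> norm (x - z) + d" using d[of i y] by linarith
      then have "real CARD('n) * B * norm ((x - Y i y) - (z - Z i y)) \<le> real CARD('n) * B * (norm (x - z) + d)"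
        using B_nonneg by (intro mult_left_mono) auto
      with K_lipschitz[of j "x - Y i y" "z - Z i y"] show ?thesis by linarith
    qed
    have "(mean_field m Y x - mean_field m Z z) $ j $ i
        = (\<integral>y. m y $ i * (K j (x - Y i y) - K j (z - Z i y)) \<partial>lebesgue)"
      using integrable_times_bounded(1)[OF m K_displacement_continuous[OF Y] K_le]
        integrable_times_bounded(1)[OF m K_displacement_continuous[OF Z] K_le]
      by (simp add: mean_field_def right_diff_distrib)
    also have "\<bar>\<dots>\<bar> \<le> real CARD('n) * B * (norm (x - z) + d) * (\<integral>y. \<bar>m y $ i\<bar> \<partial>lebesgue)"
      by (rule integrable_times_bounded(2)[OF m continuous_on_diff[OF K_displacement_continuous[OF Y] K_displacement_continuous[OF Z]] K_diff])
    also have "\<dots> \<le> real CARD('n) * B * (norm (x - z) + d) * M"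
      using B_nonneg M[of i] order_trans[OF norm_ge_zero d] by (intro mult_left_mono) auto
    finally show ?thesis .
  qed
  note F = norm_matrix_le_entries[OF this]
  have "norm (V (mean_field m Y x) - V (mean_field m Z z)) \<le> L * norm (mean_field m Y x - mean_field m Z z)"
    by (rule V_lipschitz)
  also have "\<dots> \<le> L * (real CARD('n) * (real CARD('m) * (real CARD('n) * B * (norm (x - z) + d) * M)))"
    by (rule mult_left_mono[OF F L_nonneg])
  finally show ?thesis .
qed

text \<open>The squared distances of the two families of characteristics, indexed by \<open>(i, y)\<close>, satisfy the
  assumptions of \<open>gronwall_family\<close>: they are bounded because the velocities are, and
  by \<open>mean_field_lipschitz\<close> their derivatives are bounded by a multiple of their supremum.\<close>

lemma mean_field_characteristics_unique:
  assumes m: "\<And>i. integrable lebesgue (\<lambda>y. m y $ i)"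
    and Yc: "\<And>t i. continuous_on UNIV (Y t i)" and Zc: "\<And>t i. continuous_on UNIV (Z t i)"
    and Y: "\<And>t i y. ((\<lambda>s. Y s i y) has_vector_derivative column i (V (mean_field m (Y t) (Y t i y)))) (at t)"
    and Z: "\<And>t i y. ((\<lambda>s. Z s i y) has_vector_derivative column i (V (mean_field m (Z t) (Z t i y)))) (at t)"
    and start: "\<And>i y. Y 0 i y = Z 0 i y"
  shows "Y t i y = Z t i y"
proof -
  define M where "M = (\<Sum>i\<in>UNIV. \<integral>y. \<bar>m y $ i\<bar> \<partial>lebesgue)"
  have M: "(\<integral>y. \<bar>m y $ i\<bar> \<partial>lebesgue) \<le> M" for i
    unfolding M_def by (rule member_le_sum) auto
  have M0: "0 \<le> M" unfolding M_def by (intro sum_nonneg) auto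
  define c where "c = L * (real CARD('n) * (real CARD('m) * (real CARD('n) * B * M)))"
  define b where "b = L * (real CARD('n) * (real CARD('m) * (B * M)))"
  have cb: "0 \<le> c" "0 \<le> b" using L_nonneg B_nonneg M0 by (simp_all add: c_def b_def)
  \<comment> \<open>The segment from \<open>0\<close> to \<open>t\<close>, of either sign, is parametrised by \<open>[0, 1]\<close>.\<close>
  define e where "e i y s = Y (s * t) i y - Z (s * t) i y" for i y s
  define e' where "e' i y s = t *\<^sub>R (column i (V (mean_field m (Y (s * t)) (Y (s * t) i y)))
      - column i (V (mean_field m (Z (s * t)) (Z (s * t) i y))))" for i y s
  have e: "(e i y has_vector_derivative e' i y s) (at s within {0..1})" for i y s
  proof -
    have scale: "((\<lambda>s. s * t) has_vector_derivative t) (at s within {0..1})"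
      by (auto intro!: derivative_eq_intros)
    have "((\<lambda>s. Y (s * t) i y) has_vector_derivative t *\<^sub>R column i (V (mean_field m (Y (s * t)) (Y (s * t) i y)))) (at s within {0..1})"
      using vector_diff_chain_within[OF scale has_vector_derivative_at_within[OF Y[of i y "s * t"]]]
      by (simp add: o_def)
    moreover have "((\<lambda>s. Z (s * t) i y) has_vector_derivative t *\<^sub>R column i (V (mean_field m (Z (s * t)) (Z (s * t) i y)))) (at s within {0..1})"
      using vector_diff_chain_within[OF scale has_vector_derivative_at_within[OF Z[of i y "s * t"]]]
      by (simp add: o_def)
    ultimately show ?thesis
      unfolding e_def e'_def scaleR_diff_right by (rule has_vector_derivative_diff)
  qed
  have e'_le: "norm (e' i y s) \<le> \<bar>t\<bar> * norm (V (mean_field m (Y (s * t)) (Y (s * t) i y)) - V (mean_field m (Z (s * t)) (Z (s * t) i y)))" for i y s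
    unfolding e'_def norm_scaleR column_diff[symmetric]
    by (intro mult_left_mono norm_column_le) simp
  have e_bound: "norm (e i y s) \<le> \<bar>t\<bar> * (2 * b) * exp 1" if s: "s \<in> {0..1}" for i y s
  proof -
    have "norm (e i y s) \<le> (norm (e i y 0) + \<bar>t\<bar> * (2 * b)) * exp (0 + 1)"
    proof (rule gronwall_norm[OF e])
      fix r :: real
      have "norm (V (mean_field m (Y (r * t)) (Y (r * t) i y)) - V (mean_field m (Z (r * t)) (Z (r * t) i y))) \<le> b + b"
        unfolding b_def
        by (rule order_trans[OF norm_triangle_ineq4 add_mono]) (rule mean_field_bound[OF m M] Yc Zc)+
      then have "\<bar>t\<bar> * norm (V (mean_field m (Y (r * t)) (Y (r * t) i y)) - V (mean_field m (Z (r * t)) (Z (r * t) i y))) \<le> \<bar>t\<bar> * (b + b)"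
        by (rule mult_left_mono) simp
      with e'_le[of i y r] show "norm (e' i y r) \<le> 0 * norm (e i y r) + \<bar>t\<bar> * (2 * b)" by simp
    qed (use cb s in auto)
    then show ?thesis by (simp add: e_def start)
  qed
  define u where "u p s = (norm (e (fst p) (snd p) s))\<^sup>2" for p s
  have "u (i, y) 1 \<le> 0"
  proof (rule gronwall_family[where u = u and u' = "\<lambda>p s. 2 * (e (fst p) (snd p) s \<bullet> e' (fst p) (snd p) s)"
        and M = "(\<bar>t\<bar> * (2 * b) * exp 1)\<^sup>2" and C = "4 * \<bar>t\<bar> * c"])
    fix p :: "'m \<times> (real^'n)" and s :: real assume s: "s \<in> {0..1}"
    have "(u p has_derivative (\<lambda>h. e (fst p) (snd p) s \<bullet> (h *\<^sub>R e' (fst p) (snd p) s) + (h *\<^sub>R e' (fst p) (snd p) s) \<bullet> e (fst p) (snd p) s)) (at s within {0..1})"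
      unfolding u_def power2_norm_eq_inner
      using e unfolding has_vector_derivative_def by (intro has_derivative_inner)
    then show "(u p has_real_derivative 2 * (e (fst p) (snd p) s \<bullet> e' (fst p) (snd p) s)) (at s within {0..1})"
      unfolding has_field_derivative_def
      by (rule has_derivative_eq_rhs) (auto simp: fun_eq_iff inner_commute)
    show "u p s \<le> (\<bar>t\<bar> * (2 * b) * exp 1)\<^sup>2"
      unfolding u_def by (intro power_mono e_bound s) simp
  next
    fix p :: "'m \<times> (real^'n)" and s S :: real
    assume s: "s \<in> {0..1}" and S: "\<And>q. u q s \<le> S"
    obtain i y where p: "p = (i, y)" by (cases p)
    define d where "d = sqrt S"
    have S0: "0 \<le> S" using order_trans[OF zero_le_power2 S[unfolded u_def]] .
    have d: "norm (e k z s) \<le> d" for k z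
      unfolding d_def using S[of "(k, z)"] by (intro real_le_rsqrt) (simp add: u_def)
    have "norm (V (mean_field m (Y (s * t)) (Y (s * t) i y)) - V (mean_field m (Z (s * t)) (Z (s * t) i y)))
        \<le> L * (real CARD('n) * (real CARD('m) * (real CARD('n) * B * (norm (Y (s * t) i y - Z (s * t) i y) + d) * M)))"
      by (rule mean_field_lipschitz[OF m M Yc Zc]) (rule d[unfolded e_def])
    also have "\<dots> = c * (norm (e i y s) + d)" by (simp add: c_def e_def mult_ac)
    also have "\<dots> \<le> c * (2 * d)" using d[of i y] cb by (intro mult_left_mono) auto
    finally have "norm (e' i y s) \<le> \<bar>t\<bar> * (c * (2 * d))"
      by (rule order_trans[OF e'_le mult_left_mono]) simp
    then have "e i y s \<bullet> e' i y s \<le> d * (\<bar>t\<bar> * (c * (2 * d)))"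
      by (intro order_trans[OF norm_cauchy_schwarz mult_mono[OF d]] order_trans[OF norm_ge_zero d[of i y]] norm_ge_zero)
    also have "\<dots> = 2 * \<bar>t\<bar> * c * S" using S0 by (simp add: d_def mult_ac)
    finally show "2 * (e (fst p) (snd p) s \<bullet> e' (fst p) (snd p) s) \<le> 4 * \<bar>t\<bar> * c * S" by (simp add: p mult_ac)
  qed (simp_all add: u_def e_def start)
  then show ?thesis by (simp add: u_def e_def)
qed

end

locale lagrangian_system = nonlocal_field V \<eta> L B \<rho>
  for V :: "real^'m^'n \<Rightarrow> real^'m^'n" and \<eta> L B \<rho> +
  fixes \<rho>\<^sub>o :: "real^'n \<Rightarrow> real^'m" and X :: "'m \<Rightarrow> real \<Rightarrow> real \<Rightarrow> real^'n \<Rightarrow> real^'n"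
  assumes datum_integrable: "integrable lebesgue (\<lambda>y. \<rho>\<^sub>o y $ i)"
    and flow: "is_flow UNIV (velocity V \<eta> \<rho> i) (X i)"
    and density: "\<rho> t x $ i = \<rho>\<^sub>o (X i 0 t x) $ i
      * exp (- (LBINT \<tau>=0..t. divergence (velocity V \<eta> \<rho> i \<tau>) (X i \<tau> t x)))"
begin

lemma flows: "lipschitz_flow (velocity V \<eta> \<rho> i) (velocity_jacobian i) (X i)"
  by (rule velocity_lipschitz_flow[OF flow])

text \<open>The link between the density and the mean-field system: by transport of the density,
  the convolution becomes an integral of the datum.\<close>

lemma velocity_mean_field:
  "velocity V \<eta> \<rho> i t x = column i (V (mean_field \<rho>\<^sub>o (\<lambda>k. X k t 0) x))"
proof -
  have "U t x $ j $ k = (\<integral>y. \<rho>\<^sub>o y $ k * K j (x - X k t 0 y) \<partial>lebesgue)" for j k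
    unfolding U_entry
    by (rule lipschitz_flow.lagrangian_pushforward[OF flows datum_integrable density K_shift_continuous K_le])
  then have "U t x = mean_field \<rho>\<^sub>o (\<lambda>k. X k t 0) x"
    by (simp add: mean_field_def vec_eq_iff)
  then show ?thesis by (simp add: velocity_eq)
qed

end

section \<open>Invariance\<close>

locale symmetric_lagrangian_system = lagrangian_system V \<eta> L B \<rho> \<rho>\<^sub>o X
  for V :: "real^'m^'n \<Rightarrow> real^'m^'n" and \<eta> L B \<rho> \<rho>\<^sub>o X +
  fixes R :: "real^'n^'n"
  assumes orthogonal: "orthogonal_matrix R"
    and V_equivariant: "column i (V (matrix_of_columns (\<lambda>k. w k v* R)))
      = matrix_inv R *v column i (V (matrix_of_columns w))"
    and eta_invariant: "\<eta> (R *v x) = \<eta> x"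
    and datum_invariant: "\<rho>\<^sub>o (R *v x) = \<rho>\<^sub>o x"
begin

lemma R_inverse: "(R *v x) v* R = x" "R *v (x v* R) = x"
proof -
  have "transpose R *v (R *v x) = x" "R *v (transpose R *v x) = x"
    using orthogonal by (simp_all only: orthogonal_matrix_def matrix_vector_mul_assoc matrix_vector_mul_lid)
  then show "(R *v x) v* R = x" "R *v (x v* R) = x" by simp_all
qed

lemma rotation_continuous: "continuous_on UNIV (\<lambda>y. R *v y)"
  and inverse_rotation_continuous: "continuous_on UNIV (\<lambda>y. y v* R)"
  using linear_continuous_on[OF matrix_vector_mul_bounded_linear[of R]]
    linear_continuous_on[OF matrix_vector_mul_bounded_linear[of "transpose R"]]
  by simp_all

text \<open>The chain rule for \<open>\<eta>(R z) = \<eta>(z)\<close>: the gradient satisfies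
  \<open>\<nabla>\<eta>(z) = \<nabla>\<eta>(R z) R\<close> as a row vector.\<close>

lemma K_equivariant: "K l z = (\<Sum>j\<in>UNIV. R $ j $ l * K j (R *v z))"
proof -
  have "((\<lambda>x. \<eta> (R *v x)) has_derivative (\<lambda>h. \<Sum>b\<in>Basis. ((R *v h) \<bullet> b) *\<^sub>R partial b \<eta> (R *v z))) (at z)"
    by (rule has_derivative_compose[OF bounded_linear_imp_has_derivative[OF matrix_vector_mul_bounded_linear]
          has_derivative_partials[OF eta_differentiable]])
  then have "K l z = (\<Sum>b\<in>Basis. ((R *v axis l 1) \<bullet> b) *\<^sub>R partial b \<eta> (R *v z))"
    unfolding eta_invariant by (rule partial_eq_derivative)
  also have "\<dots> = (\<Sum>j\<in>UNIV. R $ j $ l * K j (R *v z))"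
    by (simp add: sum.reindex_bij_betw[OF bij_betw_axis_Basis, symmetric] inner_axis
        matrix_vector_mult_basis column_def)
  finally show ?thesis .
qed

text \<open>Conjugating a configuration by the rotation rotates the velocity it generates. The columns \<open>w\<close>
  of the new field satisfy \<open>w k v* R = \<close> column \<open>k\<close> of the old one, by the equivariance of
  \<open>\<nabla>\<eta>\<close> and the substitution \<open>y \<mapsto> R y\<close>, which preserves both Lebesgue measure and the datum; the
  assumption on \<open>V\<close> then applies.\<close>

lemma mean_field_equivariant:
  assumes Y: "\<And>k. continuous_on UNIV (Y k)"
  shows "R *v column i (V (mean_field \<rho>\<^sub>o Y x))
    = column i (V (mean_field \<rho>\<^sub>o (\<lambda>k y. R *v Y k (y v* R)) (R *v x)))"
proof -
  define Y' where "Y' k y = R *v Y k (y v* R)" for k y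
  have YR: "continuous_on UNIV (\<lambda>y. Y k (y v* R))" for k
    by (rule continuous_on_compose2[OF Y inverse_rotation_continuous]) simp
  have Y'c: "continuous_on UNIV (Y' k)" for k
    unfolding Y'_def by (rule continuous_on_compose2[OF rotation_continuous YR]) simp
  define w where "w k = column k (mean_field \<rho>\<^sub>o Y' (R *v x))" for k
  have "(w k v* R) $ l = mean_field \<rho>\<^sub>o Y x $ l $ k" for k l
  proof -
    have int: "integrable lebesgue (\<lambda>y. \<rho>\<^sub>o y $ k * K j (R *v x - Y' k y))" for j
      by (rule integrable_times_bounded(1)[OF datum_integrable K_displacement_continuous[OF Y'c] K_le])
    have intl: "integrable lebesgue (\<lambda>y. \<rho>\<^sub>o y $ k * K l (x - Y k (y v* R)))"
      by (rule integrable_times_bounded(1)[OF datum_integrable K_displacement_continuous[OF YR] K_le])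
    have "(w k v* R) $ l = (\<Sum>j\<in>UNIV. R $ j $ l * (\<integral>y. \<rho>\<^sub>o y $ k * K j (R *v x - Y' k y) \<partial>lebesgue))"
      by (simp add: vector_matrix_mult_def w_def column_def mean_field_def mult.commute)
    also have "\<dots> = (\<integral>y. (\<Sum>j\<in>UNIV. R $ j $ l * (\<rho>\<^sub>o y $ k * K j (R *v x - Y' k y))) \<partial>lebesgue)"
      by (subst Bochner_Integration.integral_sum) (auto intro: integrable_mult_right int)
    also have "\<dots> = (\<integral>y. \<rho>\<^sub>o y $ k * K l (x - Y k (y v* R)) \<partial>lebesgue)"
    proof (rule Bochner_Integration.integral_cong[OF refl])
      fix y
      have "R *v x - Y' k y = R *v (x - Y k (y v* R))"
        by (simp add: Y'_def matrix_vector_mult_diff_distrib)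
      then show "(\<Sum>j\<in>UNIV. R $ j $ l * (\<rho>\<^sub>o y $ k * K j (R *v x - Y' k y)))
          = \<rho>\<^sub>o y $ k * K l (x - Y k (y v* R))"
        by (simp add: K_equivariant[of l] sum_distrib_left mult_ac)
    qed
    also have "\<dots> = (\<integral>y. \<rho>\<^sub>o (R *v y) $ k * K l (x - Y k ((R *v y) v* R)) * \<bar>det R\<bar> \<partial>lebesgue)"
    proof (rule lebesgue_change_of_variables(2)[symmetric, OF _ _ intl])
      show "((\<lambda>y. R *v y) has_derivative (\<lambda>h. R *v h)) (at y)" for y
        by (rule bounded_linear_imp_has_derivative[OF matrix_vector_mul_bounded_linear])
      show "bij (\<lambda>y. R *v y)"
        by (rule bij_betw_byWitness[where f' = "\<lambda>y. y v* R"]) (auto simp: R_inverse)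
    qed
    also have "\<dots> = mean_field \<rho>\<^sub>o Y x $ l $ k"
      using det_orthogonal_matrix[OF orthogonal]
      by (auto simp: R_inverse datum_invariant mean_field_def)
    finally show ?thesis .
  qed
  then have "mean_field \<rho>\<^sub>o Y x = matrix_of_columns (\<lambda>k. w k v* R)"
    by (simp add: matrix_of_columns_def vec_eq_iff)
  then have "R *v column i (V (mean_field \<rho>\<^sub>o Y x)) = R *v (matrix_inv R *v column i (V (matrix_of_columns w)))"
    by (simp add: V_equivariant)
  also have "R *v (matrix_inv R *v column i (V (matrix_of_columns w))) = column i (V (matrix_of_columns w))"
  proof -
    have "R ** transpose R = mat 1 \<and> transpose R ** R = mat 1"
      using orthogonal unfolding orthogonal_matrix_def by blast
    from someI[of "\<lambda>A. R ** A = mat 1 \<and> A ** R = mat 1", OF this]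
    have "R ** matrix_inv R = mat 1" unfolding matrix_inv_def by (rule conjunct1)
    then show ?thesis by (simp only: matrix_vector_mul_assoc matrix_vector_mul_lid)
  qed
  also have "matrix_of_columns w = mean_field \<rho>\<^sub>o Y' (R *v x)"
    by (simp add: matrix_of_columns_def w_def column_def vec_eq_iff)
  finally show ?thesis by (simp add: Y'_def[abs_def])
qed

text \<open>Both \<open>X\<close> and its conjugate by \<open>R\<close> solve the mean-field system with the same initial values.\<close>

lemma flow_equivariant_from_start: "X i t 0 (R *v y) = R *v X i t 0 y"
proof -
  have "X i t 0 z = R *v X i t 0 (z v* R)" for z
  proof (rule mean_field_characteristics_unique[where Y = "\<lambda>t i. X i t 0"
        and Z = "\<lambda>t i z. R *v X i t 0 (z v* R)", OF datum_integrable])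
    fix t i z
    show "((\<lambda>s. X i s 0 z) has_vector_derivative
        column i (V (mean_field \<rho>\<^sub>o (\<lambda>i. X i t 0) (X i t 0 z)))) (at t)"
      using lipschitz_flow.flow_solves[OF flows] by (simp add: velocity_mean_field)
    have "((\<lambda>s. R *v X i s 0 (z v* R)) has_vector_derivative
        R *v column i (V (mean_field \<rho>\<^sub>o (\<lambda>i. X i t 0) (X i t 0 (z v* R))))) (at t)"
      using lipschitz_flow.flow_solves[OF flows]
      by (intro bounded_linear.has_vector_derivative[OF matrix_vector_mul_bounded_linear])
        (simp add: velocity_mean_field)
    then show "((\<lambda>s. R *v X i s 0 (z v* R)) has_vector_derivative
        column i (V (mean_field \<rho>\<^sub>o (\<lambda>i z. R *v X i t 0 (z v* R)) (R *v X i t 0 (z v* R))))) (at t)"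
      by (simp only: mean_field_equivariant[OF lipschitz_flow.flow_continuous_space[OF flows]])
  next
    fix t i
    show c: "continuous_on UNIV (X i t 0)" by (rule lipschitz_flow.flow_continuous_space[OF flows])
    show "continuous_on UNIV (\<lambda>z. R *v X i t 0 (z v* R))"
      by (intro continuous_on_compose2[OF rotation_continuous continuous_on_compose2[OF c inverse_rotation_continuous]]) auto
  qed (simp add: lipschitz_flow.flow_start[OF flows] R_inverse)
  from this[of "R *v y"] show ?thesis by (simp add: R_inverse)
qed

lemma flow_equivariant: "X i s t (R *v x) = R *v X i s t x"
proof -
  note compose = lipschitz_flow.flow_compose[OF flows] and inverse = lipschitz_flow.flow_inverse[OF flows]
  have "X i 0 t (R *v x) = X i 0 t (R *v X i t 0 (X i 0 t x))" by (simp only: inverse)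
  also have "\<dots> = R *v X i 0 t x" by (simp only: flow_equivariant_from_start[symmetric], rule inverse)
  finally have "X i s 0 (X i 0 t (R *v x)) = R *v X i s 0 (X i 0 t x)"
    by (simp add: flow_equivariant_from_start)
  then show ?thesis by (simp add: compose)
qed

lemma velocity_equivariant: "velocity V \<eta> \<rho> i t (R *v x) = R *v velocity V \<eta> \<rho> i t x"
proof -
  have "R *v X k t 0 (y v* R) = X k t 0 y" for k y
    by (simp add: flow_equivariant_from_start[symmetric] R_inverse)
  with mean_field_equivariant[where Y = "\<lambda>k. X k t 0" and i = i and x = x,
      OF lipschitz_flow.flow_continuous_space[OF flows]]
  show ?thesis by (simp add: velocity_mean_field)
qed

text \<open>By equivariance the Jacobians at \<open>R x\<close> and at \<open>x\<close> are conjugate by \<open>R\<close>, and similar matrices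
  have the same trace.\<close>

lemma divergence_invariant:
  "divergence (velocity V \<eta> \<rho> i t) (R *v x) = divergence (velocity V \<eta> \<rho> i t) x"
proof -
  let ?A = "velocity_jacobian i t"
  have "((\<lambda>x. velocity V \<eta> \<rho> i t (R *v x)) has_derivative (\<lambda>h. ?A (R *v x) *v (R *v h))) (at x)"
    by (rule has_derivative_compose[OF bounded_linear_imp_has_derivative[OF matrix_vector_mul_bounded_linear]
          velocity_has_derivative])
  moreover have "((\<lambda>x. R *v velocity V \<eta> \<rho> i t x) has_derivative (\<lambda>h. R *v (?A x *v h))) (at x)"
    by (rule bounded_linear.has_derivative[OF matrix_vector_mul_bounded_linear velocity_has_derivative])
  ultimately have "(\<lambda>h. ?A (R *v x) *v (R *v h)) = (\<lambda>h. R *v (?A x *v h))"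
    unfolding velocity_equivariant by (rule has_derivative_unique)
  then have "?A (R *v x) ** R = R ** ?A x"
    by (simp add: matrix_eq fun_eq_iff matrix_vector_mul_assoc)
  then have "?A (R *v x) ** R ** transpose R = R ** ?A x ** transpose R" by simp
  then have "?A (R *v x) = R ** ?A x ** transpose R"
    using orthogonal by (simp add: orthogonal_matrix_def matrix_mul_assoc[symmetric])
  then have "trace (?A (R *v x)) = trace (transpose R ** (R ** ?A x))"
    by (simp add: trace_mul_sym[of "R ** ?A x"])
  also have "\<dots> = trace (?A x)"
    using orthogonal by (simp add: orthogonal_matrix_def matrix_mul_assoc)
  finally show ?thesis by (simp add: lipschitz_flow.divergence_eq_trace[OF flows])
qed

lemma density_invariant: "\<rho> t (R *v x) = \<rho> t x"
  by (simp add: vec_eq_iff density flow_equivariant datum_invariant divergence_invariant)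

end

theorem proposition2p3:
  fixes V :: "real^'m^'n \<Rightarrow> real^'m^'n"
    and \<eta> :: "real^'n \<Rightarrow> real"
    and \<rho>\<^sub>o :: "real^'n \<Rightarrow> real^'m"
    and R :: "real^'n^'n"
    and \<rho> :: "real \<Rightarrow> real^'n \<Rightarrow> real^'m"
  assumes "assumption_V V"
    and "assumption_eta \<eta>"
    and "L1_Linf_BV \<rho>\<^sub>o"
    and "orthogonal_matrix R"
    and "\<And>i (w :: 'm \<Rightarrow> real^'n).
           column i (V (matrix_of_columns (\<lambda>k. w k v* R))) =
           matrix_inv R *v column i (V (matrix_of_columns w))"
    and "\<And>x. \<eta> (R *v x) = \<eta> x"
    and "\<And>x. \<rho>\<^sub>o (R *v x) = \<rho>\<^sub>o x"
    and "solution_on UNIV V \<eta> \<rho>\<^sub>o \<rho>"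
  shows "\<forall>t x. \<rho> t (R *v x) = \<rho> t x"
proof -
  obtain L B where "nonlocal_velocity V \<eta> L B"
    using assumptions_imp_nonlocal_velocity[OF assms(1,2)] by blast
  then interpret nonlocal_velocity V \<eta> L B .
  have "C0_L1 UNIV \<rho>" using assms(8) by (simp add: solution_on_def)
  then interpret nonlocal_field V \<eta> L B \<rho> by unfold_locales
  have "\<forall>i. \<exists>X. is_flow UNIV (velocity V \<eta> \<rho> i) X \<and>
      (\<forall>t x. \<rho> t x $ i = \<rho>\<^sub>o (X 0 t x) $ i
        * exp (- (LBINT \<tau>=0..t. divergence (velocity V \<eta> \<rho> i \<tau>) (X \<tau> t x))))"
    using assms(8) unfolding solution_on_def lagrangian_solution_def by simp
  then obtain X where X: "\<And>i. is_flow UNIV (velocity V \<eta> \<rho> i) (X i)"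
    "\<And>i t x. \<rho> t x $ i = \<rho>\<^sub>o (X i 0 t x) $ i
        * exp (- (LBINT \<tau>=0..t. divergence (velocity V \<eta> \<rho> i \<tau>) (X i \<tau> t x)))"
    unfolding choice_iff by blast
  have "integrable lebesgue \<rho>\<^sub>o" using assms(3) by (simp add: L1_Linf_BV_def)
  then have datum: "integrable lebesgue (\<lambda>y. \<rho>\<^sub>o y $ i)" for i
    by (rule integrable_bounded_linear[OF bounded_linear_vec_nth])
  interpret symmetric_lagrangian_system V \<eta> L B \<rho> \<rho>\<^sub>o X R
    by unfold_locales (fact datum X assms(4-7))+
  show ?thesis using density_invariant by blast
qed

end
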